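(* Let $\boldsymbol\theta=(\theta_1,\theta_2,\dots)$ be a non-negative sequence such that $0<\sum_i\theta_i<\infty$. The distributions $\mathbf{ST}^{\boldsymbol\theta}_n$, $n\geq 1$, can be coupled as a Markov process $(\mathcal{T}_n)_{n\geq 1}$ (i.e. $\mathcal{T}_n$ has law $\mathbf{ST}^{\boldsymbol\theta}_n$ for every $n\ge1$) such that $\mathcal{T}_1\subset\mathcal{T}_2\subset\mathcal{T}_3\subset\cdots\subset\mathbb{U}$.
   Context: The Ulam--Harris tree is the set of finite words $\mathbb{U}=\bigcup_{h\geq 0}\{1,2,\dots\}^h$; for $u\in\mathbb{U}$, $i\ge1$, $ui$ is the word $u$ with letter $i$ appended. A rooted subtree of $\mathbb{U}$ is a non-empty finite subset $\tau\subset\mathbb{U}$ such that for all $u\in\mathbb{U}$ and $i\in\{1,2,\dots\}$, $ui\in\tau$ implies $u\in\tau$. The set of rooted subtrees with $n$ vertices (elements) is denoted by $\mathbb{t}_n$. For $i\in\{1,2,\dots\}$ and a rooted subtree $\tau$, $N_i(\tau)$ is the number of vertices of $\tau$ of the form $vi$ with $v\in\mathbb{U}$ (vertices of type $i$; the root has no type). For $n\geq1$, $\mathbf{ST}^{\boldsymbol\theta}_n$ is the probability distribution on $\mathbb{t}_n$ given by $$\mathbf{ST}^{\boldsymbol\theta}_n(\tau)=\frac{\prod_{i\geq 1}\theta_i^{N_i(\tau)}}{\sum_{\tau'\in\mathbb{t}_n}\prod_{i\geq 1}\theta_i^{N_i(\tau')}},\qquad \tau\in\mathbb{t}_n,$$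 with the convention $0^0=1$. A coupling of a family of probability distributions is a family of random variables on a common probability space having these respective laws. Markov processes may be time-inhomogeneous. *)

theory Defs
  imports "HOL-Probability.Probability"
begin

definition ulam_harris :: "nat list set" where
  "ulam_harris = {u. \<forall>i\<in>set u. 1 \<le> i}"

definition rooted_subtree :: "nat list set \<Rightarrow> bool" where
  "rooted_subtree \<tau> \<longleftrightarrow>
     \<tau> \<subseteq> ulam_harris \<and> finite \<tau> \<and> \<tau> \<noteq> {} \<and>
     (\<forall>u\<in>ulam_harris. \<forall>i\<ge>1. u @ [i] \<in> \<tau> \<longrightarrow> u \<in> \<tau>)"

definition rooted_subtrees :: "nat \<Rightarrow> nat list set set" where
  "rooted_subtrees n = {\<tau>. rooted_subtree \<tau> \<and> card \<tau> = n}"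

definition num_type :: "nat \<Rightarrow> nat list set \<Rightarrow> nat" where
  "num_type i \<tau> = card {u \<in> \<tau>. \<exists>v\<in>ulam_harris. u = v @ [i]}"

(* The product over all i \<ge> 1, restricted to the finitely many indices whose
   exponent is non-zero; every other factor is x ^ 0 = 1, also for x = 0. *)
definition weight :: "(nat \<Rightarrow> real) \<Rightarrow> nat list set \<Rightarrow> real" where
  "weight \<theta> \<tau> = (\<Prod>i\<in>{i. 1 \<le> i \<and> num_type i \<tau> \<noteq> 0}. \<theta> i ^ num_type i \<tau>)"

definition ST_mass :: "(nat \<Rightarrow> real) \<Rightarrow> nat \<Rightarrow> nat list set \<Rightarrow> real" where
  "ST_mass \<theta> n \<tau> = weight \<theta> \<tau> / infsum (weight \<theta>) (rooted_subtrees n)"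

(* That this is a probability measure is not built into the definition. *)
definition ST :: "(nat \<Rightarrow> real) \<Rightarrow> nat \<Rightarrow> nat list set measure" where
  "ST \<theta> n = point_measure (rooted_subtrees n) (\<lambda>\<tau>. ennreal (ST_mass \<theta> n \<tau>))"

(* (Possibly time-inhomogeneous) Markov process in discrete time n = 1, 2, ...
   whose state space S n at time n is countable and carries the discrete
   sigma-algebra; X 0 and S 0 play no role. *)
definition markov_process ::
    "'w measure \<Rightarrow> (nat \<Rightarrow> 's set) \<Rightarrow> (nat \<Rightarrow> 'w \<Rightarrow> 's) \<Rightarrow> bool" where
  "markov_process M S X \<longleftrightarrow>
     prob_space M \<and>
     (\<forall>n\<ge>1. countable (S n) \<and> X n \<in> measurable M (count_space (S n))) \<and>
     (\<forall>n\<ge>1. \<forall>x y.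
        \<P>(\<omega> in M. \<forall>k\<in>{1..n}. X k \<omega> = x k) > 0 \<longrightarrow>
        \<P>(\<omega> in M. X (Suc n) \<omega> = y \<bar> \<forall>k\<in>{1..n}. X k \<omega> = x k) =
        \<P>(\<omega> in M. X (Suc n) \<omega> = y \<bar> X n \<omega> = x n))"

end

theory Submission
  imports Defs
begin

text \<open>
  Write \<open>Z\<^sub>n\<close> for the total weight of the trees with \<open>n\<close>
  vertices. A tree is a root together with a possibly empty subtree at each letter
  \<open>i\<close>, so \<open>T(x) = \<Sum>\<^sub>n Z\<^sub>n x\<^sup>n\<close> satisfies
  \<open>T = x \<Prod>\<^sub>i (1 + \<theta>\<^sub>i T)\<close>; and given the sizes of the
  subtrees of the root, these subtrees are independent random trees of the same kind. Hence
  a leaf can be added recursively: choose the letter whose subtree is to grow, with a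
  probability depending on the vector of subtree sizes only, and continue in that subtree
  until an empty place is reached. The problem is to choose these probabilities so that the
  size vector of the random tree on \<open>n\<close> vertices is carried to that of the tree
  on \<open>n + 1\<close> vertices.

  The letters are treated one after the other. At letter \<open>i\<close> there are only two
  numbers, the size \<open>k\<close> of the subtree at \<open>i\<close> and the total size
  \<open>l\<close> of the subtrees at later letters, and given \<open>k + l = m\<close> the
  pair has weight \<open>slot i k * sibs (Suc i) l\<close>, where \<open>slot i\<close> and
  \<open>sibs i\<close> are the coefficient sequences of \<open>1 + \<theta>\<^sub>i
  T\<close> and \<open>\<Prod>\<^bsub>j \<ge> i\<^esub> (1 + \<theta>\<^sub>j T)\<close>.
  One can pass from \<open>m\<close> to \<open>m + 1\<close> by increasing exactly one of
  the two numbers if and only if the two distribution functions interlace. If the sequences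
  were log-concave this would be a standard comparison of likelihood ratios, but they are
  log-convex. That is just as good: the ratios that have to be compared are then monotone up
  to the boundary, and the interlacing reduces to one inequality at the boundary for each of
  the two coordinates (lemma \<open>cum_monotone\<close>).

  Both the log-convexity and the boundary inequalities express total positivity of order
  two. The elementary symmetric functions of the weights are log-concave; exploring the
  vertices of a forest one by one multiplies by a matrix built from them, whose minors of
  order two are therefore nonnegative; and by the Cauchy-Binet formula (lemma
  \<open>lr_le_sum\<close>) the same holds for the array \<open>forest n r\<close> of
  coefficients of \<open>x\<^sup>n\<close> in \<open>T\<^sup>r\<close>. Log-convexity of
  \<open>sibs i\<close> is a minor of order two in a factorisation of the Hankel matrix of
  that sequence.

  Besides the probabilities \<open>up\<close> of growing at a letter there are probabilities
  \<open>down\<close> of shrinking, and the two are in detailed balance. Multiplying along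
  the path to a leaf gives probabilities of adding and of deleting that leaf which are in
  detailed balance for the weights of trees divided by \<open>Z\<^sub>n\<close> (lemma
  \<open>detailed_balance\<close>). As both are probability distributions, growing maps the
  law on \<open>n\<close> vertices to the law on \<open>n + 1\<close> vertices; this also
  identifies the numbers \<open>Z\<^sub>n\<close>, defined by a recursion, with the sums
  over all trees. The process is the Markov chain with these transitions.
\<close>

section \<open>Likelihood ratio order and log-convexity\<close>

text \<open>
  For positive sequences this says that the ratio \<open>v k / u k\<close> is nondecreasing
  in \<open>k\<close>; the form without division also makes sense when there are zeros, and
  says that the minors of order two of the matrix with rows \<open>u\<close> and
  \<open>v\<close> are nonnegative.
\<close>
definition lr_le :: "(nat \<Rightarrow> real) \<Rightarrow> (nat \<Rightarrow> real) \<Rightarrow> bool" where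
  "lr_le u v \<longleftrightarrow> (\<forall>k l. k < l \<longrightarrow> u l * v k \<le> u k * v l)"

lemma lr_leD: "lr_le u v \<Longrightarrow> k \<le> l \<Longrightarrow> u l * v k \<le> u k * v l"
  unfolding lr_le_def by (cases "k = l") auto

text \<open>
  The Cauchy-Binet formula for minors of order two: the difference of the two sides is the
  sum, over all pairs of indices, of products of a minor of the rows \<open>x, y\<close> and
  a minor of the rows \<open>g, h\<close>.
\<close>
lemma lr_le_sum:
  assumes "lr_le x y" "lr_le g h"
  shows "(\<Sum>k\<le>N. x k * h k) * (\<Sum>k\<le>N. y k * g k) \<le> (\<Sum>k\<le>N. x k * g k) * (\<Sum>k\<le>N. y k * h k)"
proof -
  \<comment> \<open>A product of two minors; the double sum counts each unordered pair of indices twice.\<close>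
  let ?D = "\<lambda>k l. (x k * y l - x l * y k) * (g k * h l - g l * h k)"
  have nonneg: "0 \<le> ?D k l" for k l
  proof (cases "k \<le> l")
    case True
    then show ?thesis using lr_leD[OF assms(1) True] lr_leD[OF assms(2) True] by simp
  next
    case False
    then have "l \<le> k" by simp
    then have "0 \<le> (x l * y k - x k * y l) * (g l * h k - g k * h l)"
      using lr_leD[OF assms(1)] lr_leD[OF assms(2)] by simp
    also have "\<dots> = ?D k l" by (simp add: algebra_simps)
    finally show ?thesis .
  qed
  define S where "S = (\<lambda>u v. \<Sum>k\<le>N. u k * v k :: real)"
  have prod: "(\<Sum>k\<le>N. \<Sum>l\<le>N. (u k * v k) * (u' l * v' l)) = S u v * S u' v'" for u v u' v'
    by (simp add: S_def sum_product)
  have "0 \<le> (\<Sum>k\<le>N. \<Sum>l\<le>N. ?D k l)"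
    by (intro sum_nonneg nonneg)
  also have "\<dots> = (\<Sum>k\<le>N. \<Sum>l\<le>N. (x k * g k) * (y l * h l) - (x k * h k) * (y l * g l)
        - (y k * g k) * (x l * h l) + (y k * h k) * (x l * g l))"
    by (intro sum.cong refl) (simp add: algebra_simps)
  also have "\<dots> = 2 * (S x g * S y h - S x h * S y g)"
    unfolding sum.distrib sum_subtractf prod by simp
  finally show ?thesis by (simp add: S_def)
qed

text \<open>
  Successive ratios are nondecreasing. Comparing arbitrary indices instead of neighbouring
  ones keeps the notion useful for sequences with zeros.
\<close>
definition log_convex :: "(nat \<Rightarrow> real) \<Rightarrow> bool" where
  "log_convex u \<longleftrightarrow> (\<forall>s t. s \<le> t \<longrightarrow> u (Suc s) * u t \<le> u s * u (Suc t))"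

section \<open>Elementary symmetric functions of the weights\<close>

text \<open>
  Letters are numbered from 1. Giving the letter 0 the weight 0 allows words over all
  natural numbers, since trees in which the letter 0 occurs then have weight 0.
\<close>
locale edge_weights =
  fixes \<theta> :: "nat \<Rightarrow> real"
  assumes nonneg: "0 \<le> \<theta> i"
    and summable: "summable \<theta>"
    and nontrivial: "\<exists>i. 0 < \<theta> i"
    and zero_at_0: "\<theta> 0 = 0"
begin

text \<open>
  The elementary symmetric function of degree \<open>r\<close> of the weights
  \<open>\<theta>\<^sub>i, \<theta>\<^bsub>i+1\<^esub>, \<dots>\<close>, that is the total
  weight of the sets of \<open>r\<close> letters that are at least \<open>i\<close>. The
  recursion removes the smallest letter of the set.
\<close>
primrec esym :: "nat \<Rightarrow> nat \<Rightarrow> real" where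
  "esym 0 = (\<lambda>i. 1)"
| "esym (Suc r) = (\<lambda>i. \<Sum>j. \<theta> (j + i) * esym r (Suc (j + i)))"

lemma suminf_weights_pos: "0 < suminf \<theta>"
proof -
  obtain i where "0 < \<theta> i" using nontrivial by blast
  then show ?thesis using nonneg summable suminf_pos_iff by blast
qed

lemma esym_bounds: "0 \<le> esym r i \<and> esym r i \<le> suminf \<theta> ^ r"
  and esym_summable: "summable (\<lambda>j. \<theta> j * esym r (Suc j))"
proof -
  have *: "(\<forall>i. 0 \<le> esym r i \<and> esym r i \<le> suminf \<theta> ^ r) \<and> summable (\<lambda>j. \<theta> j * esym r (Suc j))"
  proof (induction r)
    case 0 show ?case using summable by simp
  next
    case (Suc r)
    let ?h = "\<lambda>j. \<theta> j * esym r (Suc j)"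
    have sm: "summable (\<lambda>j. ?h (j + i))" for i
      using Suc by (subst summable_iff_shift) auto
    have le: "?h j \<le> suminf \<theta> ^ r * \<theta> j" for j
      using Suc mult_left_mono[OF _ nonneg[of j], of "esym r (Suc j)" "suminf \<theta> ^ r"] by (simp add: mult.commute)
    have bnd: "0 \<le> esym (Suc r) i \<and> esym (Suc r) i \<le> suminf \<theta> ^ Suc r" for i
    proof
      show "0 \<le> esym (Suc r) i" using Suc nonneg sm by (auto intro!: suminf_nonneg)
      have "esym (Suc r) i \<le> (\<Sum>j. suminf \<theta> ^ r * \<theta> (j + i))"
        using le sm summable by (auto intro!: suminf_le summable_mult simp: summable_iff_shift)
      also have "\<dots> = suminf \<theta> ^ r * (\<Sum>j. \<theta> (j + i))"
        using summable by (intro suminf_mult) (simp add: summable_iff_shift)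
      also have "(\<Sum>j. \<theta> (j + i)) \<le> suminf \<theta>"
        using suminf_minus_initial_segment[OF summable, of i] nonneg by (simp add: sum_nonneg)
      finally show "esym (Suc r) i \<le> suminf \<theta> ^ Suc r"
        using suminf_weights_pos by (simp add: mult.commute mult_right_mono)
    qed
    have "summable (\<lambda>j. \<theta> j * esym (Suc r) (Suc j))"
    proof (rule summable_comparison_test')
      show "summable (\<lambda>j. suminf \<theta> ^ Suc r * \<theta> j)" using summable by (rule summable_mult)
      show "norm (\<theta> j * esym (Suc r) (Suc j)) \<le> suminf \<theta> ^ Suc r * \<theta> j" if "0 \<le> j" for j
        using mult_left_mono[OF conjunct2[OF bnd[of "Suc j"]] nonneg[of j]] mult_nonneg_nonneg[OF nonneg[of j] conjunct1[OF bnd[of "Suc j"]]]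
        by (simp only: mult.commute real_norm_def abs_of_nonneg)
    qed
    with bnd show ?case by blast
  qed
  show "0 \<le> esym r i \<and> esym r i \<le> suminf \<theta> ^ r" using * by blast
  show "summable (\<lambda>j. \<theta> j * esym r (Suc j))" using * by blast
qed

declare esym.simps(2) [simp del]

lemma esym_nonneg [simp]: "0 \<le> esym r i"
  using esym_bounds by blast

text \<open>
  A set of letters either avoids the letter \<open>i\<close> or consists of it and of larger
  letters.
\<close>
lemma esym_step: "esym (Suc r) i = esym (Suc r) (Suc i) + \<theta> i * esym r (Suc i)"
proof -
  let ?h = "\<lambda>j. \<theta> j * esym r (Suc j)"
  have "summable (\<lambda>j. ?h (j + i))" using esym_summable[of r] by (subst summable_iff_shift)
  from suminf_split_head[OF this] show ?thesis by (simp add: esym.simps)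
qed

lemma esym_tendsto_0: "esym (Suc r) \<longlonglongrightarrow> 0"
proof -
  let ?h = "\<lambda>j. \<theta> j * esym r (Suc j)"
  have "esym (Suc r) i = suminf ?h - sum ?h {..<i}" for i
    using suminf_minus_initial_segment[OF esym_summable[of r], of i] by (simp add: esym.simps)
  moreover have "(\<lambda>i. suminf ?h - sum ?h {..<i}) \<longlonglongrightarrow> suminf ?h - suminf ?h"
    by (intro tendsto_intros summable_LIMSEQ esym_summable)
  ultimately show ?thesis by (simp add: LIMSEQ_def)
qed

lemma esym_Suc_le: "esym (Suc r) i \<le> suminf \<theta> ^ r * esym (Suc 0) i"
proof -
  have s: "summable (\<lambda>j. \<theta> (j + i))" "summable (\<lambda>j. \<theta> (j + i) * esym r (Suc (j + i)))"
    using summable summable_iff_shift[of "\<lambda>j. \<theta> j * esym r (Suc j)" i] esym_summable[of r] by (simp_all add: summable_iff_shift)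
  have "\<theta> (j + i) * esym r (Suc (j + i)) \<le> suminf \<theta> ^ r * \<theta> (j + i)" for j
    using mult_left_mono[OF conjunct2[OF esym_bounds[of r "Suc (j + i)"]] nonneg[of "j + i"]] by (simp add: mult.commute)
  then have "esym (Suc r) i \<le> (\<Sum>j. suminf \<theta> ^ r * \<theta> (j + i))"
    unfolding esym.simps using s by (intro suminf_le summable_mult)
  then show ?thesis using s by (simp add: suminf_mult esym.simps)
qed

text \<open>
  Newton's inequality for infinitely many weights. The difference of the two sides is
  nonincreasing in \<open>i\<close>, because putting the letter \<open>i\<close> back adds
  nonnegative multiples of differences of the same form with smaller \<open>p + q\<close>;
  and it tends to 0 as \<open>i\<close> grows.
\<close>
lemma esym_log_concave:
  assumes "q \<le> p"
  shows "esym (p + d) i * esym q i \<le> esym p i * esym (q + d) i"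
  using assms
proof (induction "p + q" arbitrary: p q d i rule: less_induct)
  case less
  show ?case
  proof (cases "d = 0 \<or> p = 0")
    case True
    then show ?thesis using less.prems by auto
  next
    case False
    then obtain d' p' where d: "d = Suc d'" and p: "p = Suc p'" by (metis not0_implies_Suc)
    let ?g = "\<lambda>i. esym p i * esym (q + d) i - esym (p + d) i * esym q i"
    \<comment> \<open>Dropping more and more letters leaves elementary symmetric functions of an empty family.\<close>
    have lim: "?g \<longlonglongrightarrow> 0"
    proof -
      have "esym q \<longlonglongrightarrow> (if q = 0 then 1 else 0)"
        using esym_tendsto_0[of "q - 1"] by (cases q) auto
      then have "?g \<longlonglongrightarrow> 0 * 0 - 0 * (if q = 0 then 1 else 0)"
        unfolding p d add_Suc add_Suc_right by (intro tendsto_intros esym_tendsto_0)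
      then show ?thesis by simp
    qed
    \<comment> \<open>Restoring the letter \<open>i\<close> adds multiples of differences of the same kind
        with smaller index sum.\<close>
    have "?g (Suc i) \<le> ?g i" for i
    proof -
      let ?E = "\<lambda>r. esym r (Suc i)" and ?t = "\<theta> i"
      have IH: "?E (p1 + d) * ?E q1 \<le> ?E p1 * ?E (q1 + d)" if "p1 + q1 < p + q" "q1 \<le> p1" for p1 q1
        using less.hyps that by blast
      show ?thesis
      proof (cases q)
        case 0
        have "?g i - ?g (Suc i) = ?t * (?E p * ?E d' + (?E p' * ?E d - ?E (p' + d))) + ?t\<^sup>2 * (?E p' * ?E d')"
          unfolding 0 p d using esym_step[of p' i] esym_step[of "d'" i] esym_step[of "p' + Suc d'" i]
          by (simp add: algebra_simps power2_eq_square)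
        moreover have "?E (p' + d) \<le> ?E p' * ?E d" using IH[of p' 0] 0 p by simp
        ultimately show ?thesis using nonneg[of i]
          by (smt (verit) mult_nonneg_nonneg esym_nonneg zero_le_power2)
      next
        case (Suc q')
        have eq: "?g i - ?g (Suc i) = ?t * ((?E p * ?E (q' + d) - ?E (p + d) * ?E q') + (?E p' * ?E (q + d) - ?E (p' + d) * ?E q))
            + ?t\<^sup>2 * (?E p' * ?E (q' + d) - ?E (p' + d) * ?E q')"
          unfolding Suc p using esym_step[of p' i] esym_step[of "q' + d" i] esym_step[of "p' + d" i] esym_step[of q' i]
          by (simp add: algebra_simps power2_eq_square)
        have t2: "0 \<le> ?E p' * ?E (q' + d) - ?E (p' + d) * ?E q'" using IH[of p' q'] less.prems p Suc by simp
        have t1: "0 \<le> (?E p * ?E (q' + d) - ?E (p + d) * ?E q') + (?E p' * ?E (q + d) - ?E (p' + d) * ?E q)"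
        proof (cases "p = q")
          case True
          then show ?thesis using p Suc by (simp add: algebra_simps)
        next
          case False
          then show ?thesis using IH[of p q'] IH[of p' q] less.prems p Suc by simp
        qed
        show ?thesis using eq mult_nonneg_nonneg[OF nonneg[of i] t1] mult_nonneg_nonneg[OF zero_le_power2[of ?t] t2] by linarith
      qed
    qed
    then have "decseq ?g" by (simp add: decseq_Suc_iff)
    from decseq_ge[OF this lim, of i] show ?thesis by simp
  qed
qed

text \<open>
  Log-concavity, with the letters \<open>i, \<dots>, j - 1\<close> added to one of the two
  families. Each added letter replaces the sequence by a combination of itself and its
  shift, and the inequality survives both.
\<close>
lemma esym_ratio:
  assumes "i \<le> j" "q \<le> p"
  shows "esym (p + d) j * esym q i \<le> esym p j * esym (q + d) i"
  using assms
proof (induction i arbitrary: q rule: inc_induct)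
  case base
  then show ?case by (rule esym_log_concave)
next
  case (step n)
  show ?case
  proof (cases q)
    case 0
    have "esym d (Suc n) \<le> esym d n"
      using esym_step[of "d-1" n] nonneg[of n] by (cases d) auto
    then have "esym p j * esym d (Suc n) \<le> esym p j * esym d n" by (intro mult_left_mono) auto
    then show ?thesis using step.IH[of 0] 0 by simp
  next
    case (Suc q')
    have "esym (p + d) j * esym q n = esym (p + d) j * esym q (Suc n) + \<theta> n * (esym (p + d) j * esym q' (Suc n))"
      using esym_step[of q' n] Suc by (simp add: algebra_simps)
    also have "\<dots> \<le> esym p j * esym (q + d) (Suc n) + \<theta> n * (esym p j * esym (q' + d) (Suc n))"
      using step.IH[of q] step.IH[of q'] step.prems Suc nonneg[of n] by (intro add_mono mult_left_mono) auto
    also have "\<dots> = esym p j * esym (q + d) n"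
      using esym_step[of "q' + d" n] Suc by (simp add: algebra_simps)
    finally show ?thesis .
  qed
qed

section \<open>Weights of forests and of lists of siblings\<close>

text \<open>
  Exploring a forest of \<open>r\<close> trees: the root of the first tree is removed and
  its \<open>k + 1 - r\<close> subtrees join the forest, which then has \<open>k\<close>
  trees. The entry is the total weight of the possible sets of children.
\<close>
definition explore :: "nat \<Rightarrow> nat \<Rightarrow> real" where
  "explore r k = (if r = 0 \<or> Suc k < r then 0 else esym (Suc k - r) 0)"

text \<open>
  The total weight of the sequences of \<open>r\<close> trees with \<open>n\<close> vertices
  altogether, that is the coefficient of \<open>x\<^sup>n\<close> in
  \<open>T\<^sup>r\<close>. In particular \<open>forest n 1\<close> is the weight
  \<open>Z\<^sub>n\<close> of the trees with \<open>n\<close> vertices. Each step of the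
  recursion explores one vertex.
\<close>
primrec forest :: "nat \<Rightarrow> nat \<Rightarrow> real" where
  "forest 0 = (\<lambda>r. if r = 0 then 1 else 0)"
| "forest (Suc n) = (\<lambda>r. \<Sum>k\<le>n. explore r k * forest n k)"

lemma explore_nonneg [simp]: "0 \<le> explore r k" by (simp add: explore_def)

text \<open>
  The matrix is constant along diagonals and its entries form a log-concave sequence.
\<close>
lemma explore_TP2:
  assumes "r \<le> r'" "k \<le> k'"
  shows "explore r k' * explore r' k \<le> explore r k * explore r' k'"
proof (cases "r = 0 \<or> Suc k < r'")
  case False
  then have "esym ((Suc k - r) + (k' - k)) 0 * esym (Suc k - r') 0 \<le> esym (Suc k - r) 0 * esym ((Suc k - r') + (k' - k)) 0"
    using assms by (intro esym_log_concave) auto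
  moreover have "(Suc k - r) + (k' - k) = Suc k' - r" "(Suc k - r') + (k' - k) = Suc k' - r'"
    using False assms by auto
  ultimately show ?thesis using False assms by (simp add: explore_def)
qed (auto simp: explore_def)

declare forest.simps(2) [simp del] sum.atMost_Suc [simp del]

lemma forest_nonneg [simp]: "0 \<le> forest n r"
  by (induction n arbitrary: r) (auto intro!: sum_nonneg simp: forest.simps(2))

lemma forest_eq_0: "n < r \<Longrightarrow> forest n r = 0"
  by (induction n arbitrary: r) (auto intro!: sum.neutral simp: explore_def forest.simps(2))

lemma forest_Suc:
  assumes "n \<le> N" shows "forest (Suc n) r = (\<Sum>k\<le>N. explore r k * forest n k)"
  unfolding forest.simps(2) using assms by (intro sum.mono_neutral_left) (auto simp: forest_eq_0)

lemma forest_Suc_0 [simp]: "forest (Suc n) 0 = 0"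
  by (simp add: explore_def forest.simps(2))

lemma forest_1_1 [simp]: "forest (Suc 0) (Suc 0) = 1"
  by (simp add: explore_def forest.simps(2))

text \<open>
  The array \<open>forest\<close> arises from the first unit vector by repeated
  multiplication with a totally positive matrix, which preserves the likelihood ratio order
  of consecutive rows.
\<close>
lemma forest_lr: "lr_le (forest n) (forest (Suc n))"
proof (induction n)
  case 0 show ?case by (auto simp: lr_le_def)
next
  case (Suc n)
  show ?case unfolding lr_le_def
  proof (intro allI impI)
    fix r r' :: nat assume "r < r'"
    then have "lr_le (explore r) (explore r')" using explore_TP2 by (auto simp: lr_le_def)
    from lr_le_sum[OF this Suc, of "Suc n"]
    show "forest (Suc n) r' * forest (Suc (Suc n)) r \<le> forest (Suc n) r * forest (Suc (Suc n)) r'"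
      using forest_Suc[of n "Suc n"] forest_Suc[of "Suc n" "Suc n"] by (simp add: mult.commute)
  qed
qed

text \<open>
  This is \<open>T\<^bsup>r+r'\<^esup> = T\<^sup>r T\<^bsup>r'\<^esup>\<close>, read off
  from the exploration: the first \<open>r\<close> trees are explored before the others.
\<close>
lemma forest_add: "forest m (r + r') = (\<Sum>k\<le>m. forest k r * forest (m - k) r')"
proof (induction m arbitrary: r r')
  case 0 show ?case by auto
next
  case (Suc m)
  show ?case
  proof (cases r)
    case 0
    have "(\<Sum>k\<le>Suc m. forest k 0 * forest (Suc m - k) r') = (\<Sum>k\<in>{0}. forest k 0 * forest (Suc m - k) r')"
      by (intro sum.mono_neutral_right) (auto simp: gr0_conv_Suc)
    then show ?thesis using 0 by simp
  next
    case (Suc s)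
    have A: "forest (Suc n) (Suc s + r') = (\<Sum>t\<le>n. esym t 0 * forest n (t + s + r'))" for n s r'
    proof -
      have "forest (Suc n) (Suc s + r') = (\<Sum>k\<le>n + s + r'. explore (Suc s + r') k * forest n k)"
        by (rule forest_Suc) simp
      also have "\<dots> = (\<Sum>k\<in>{s+r'..n+s+r'}. esym (k - (s + r')) 0 * forest n k)"
        by (intro sum.mono_neutral_cong_right) (auto simp: explore_def)
      also have "\<dots> = (\<Sum>t\<le>n. esym t 0 * forest n (t + s + r'))"
        by (rule sum.reindex_bij_witness[of _ "\<lambda>t. t + s + r'" "\<lambda>k. k - (s + r')"]) auto
      finally show ?thesis .
    qed
    have B: "forest (Suc k) (Suc s) = (\<Sum>t\<le>m. esym t 0 * forest k (t + s))" if "k \<le> m" for k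
    proof -
      have "forest (Suc k) (Suc s) = (\<Sum>t\<le>k. esym t 0 * forest k (t + s))" using A[of k s 0] by simp
      also have "\<dots> = (\<Sum>t\<le>m. esym t 0 * forest k (t + s))"
        using that by (intro sum.mono_neutral_left) (auto simp: forest_eq_0)
      finally show ?thesis .
    qed
    have "forest (Suc m) (r + r') = (\<Sum>t\<le>m. esym t 0 * (\<Sum>k\<le>m. forest k (t + s) * forest (m - k) r'))"
      unfolding Suc A by (simp only: Suc.IH[of "_ + s" r'])
    also have "\<dots> = (\<Sum>k\<le>m. (\<Sum>t\<le>m. esym t 0 * forest k (t + s)) * forest (m - k) r')"
      unfolding sum_distrib_left sum_distrib_right mult.assoc by (rule sum.swap)
    also have "\<dots> = (\<Sum>k\<le>m. forest (Suc k) r * forest (m - k) r')"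
      using B Suc by (intro sum.cong) auto
    also have "\<dots> = (\<Sum>k\<le>Suc m. forest k r * forest (Suc m - k) r')"
      unfolding sum.atMost_Suc_shift using Suc by simp
    finally show ?thesis .
  qed
qed

text \<open>
  The total weight of the families of subtrees at the letters \<open>i, i + 1,
  \<dots>\<close> of one vertex that have \<open>m\<close> vertices altogether;
  \<open>r\<close> is the number of nonempty ones. This is the coefficient of
  \<open>x\<^sup>m\<close> in \<open>\<Prod>\<^bsub>j \<ge> i\<^esub> (1 + \<theta>\<^sub>j
  T)\<close>.
\<close>
definition sibs :: "nat \<Rightarrow> nat \<Rightarrow> real" where
  "sibs i m = (\<Sum>r\<le>m. esym r i * forest m r)"

text \<open>
  The total weight of what may sit at the letter \<open>i\<close> of a vertex and has
  \<open>k\<close> vertices: nothing, or a tree together with the edge leading to it. This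
  is the coefficient of \<open>x\<^sup>k\<close> in \<open>1 + \<theta>\<^sub>i T\<close>.
\<close>
definition slot :: "nat \<Rightarrow> nat \<Rightarrow> real" where
  "slot i k = (if k = 0 then 1 else \<theta> i * forest k 1)"

lemma sibs_alt: "m \<le> N \<Longrightarrow> sibs i m = (\<Sum>r\<le>N. esym r i * forest m r)"
  unfolding sibs_def by (intro sum.mono_neutral_left) (auto simp: forest_eq_0)

lemma sibs_nonneg [simp]: "0 \<le> sibs i m" by (auto simp: sibs_def intro!: sum_nonneg)

lemma slot_nonneg [simp]: "0 \<le> slot i k" by (simp add: slot_def nonneg)

lemma sibs_0 [simp]: "sibs i 0 = 1" by (simp add: sibs_def)

lemma sibs_1: "sibs i (Suc 0) = esym (Suc 0) i" by (simp add: sibs_def sum.atMost_Suc)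

lemma slot_0 [simp]: "slot i 0 = 1" by (simp add: slot_def)

text \<open>
  A tree is a root and the family of its subtrees.
\<close>
lemma forest_one: "forest (Suc n) (Suc 0) = sibs 0 n"
  by (simp add: sibs_def explore_def forest.simps(2))

lemma esym_1_pos: "0 < esym (Suc 0) 0"
  using suminf_weights_pos by (simp add: esym.simps)

lemma forest_one_pos: "0 < forest (Suc n) (Suc 0)"
proof (induction n)
  case 0 show ?case by (simp add: explore_def)
next
  case (Suc n)
  have "0 < esym (Suc 0) 0 * forest (Suc n) (Suc 0)" using Suc esym_1_pos by simp
  also have "\<dots> \<le> sibs 0 (Suc n)" unfolding sibs_def
    by (rule member_le_sum) (auto)
  finally show ?case by (simp only: forest_one)
qed

lemma sibs_0_pos: "0 < sibs 0 n" using forest_one_pos[of n] by (simp only: forest_one)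

text \<open>
  With \<open>sibs_zero\<close> this shows that the sequence \<open>sibs i\<close> either is
  positive or, if no letter from \<open>i\<close> on has positive weight, vanishes beyond
  index 0.
\<close>
lemma sibs_pos: "0 < esym (Suc 0) i \<Longrightarrow> 0 < sibs i n"
proof (cases n)
  case (Suc m)
  assume "0 < esym (Suc 0) i"
  then have "0 < esym (Suc 0) i * forest n (Suc 0)" using forest_one_pos Suc by simp
  also have "\<dots> \<le> sibs i n" unfolding sibs_def
    by (rule member_le_sum) (auto simp: Suc)
  finally show ?thesis .
qed simp

lemma sibs_zero: "esym (Suc 0) i = 0 \<Longrightarrow> 0 < n \<Longrightarrow> sibs i n = 0"
proof -
  assume "esym (Suc 0) i = 0"
  then have "esym (Suc r) i = 0" for r using esym_Suc_le[of r i] esym_nonneg[of "Suc r" i] by simp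
  then show "sibs i n = 0" if "0 < n"
    unfolding sibs_def using that by (intro sum.neutral) (metis forest_Suc_0 gr0_implies_Suc mult_zero_left mult_zero_right not0_implies_Suc)
qed

text \<open>
  The identity \<open>\<Prod>\<^bsub>j \<ge> i\<^esub> (1 + \<theta>\<^sub>j T) = (1 +
  \<theta>\<^sub>i T) \<Prod>\<^bsub>j > i\<^esub> (1 + \<theta>\<^sub>j T)\<close>.
\<close>
lemma sibs_conv: "sibs i m = (\<Sum>k\<le>m. slot i k * sibs (Suc i) (m - k))"
proof -
  have "sibs i m = (\<Sum>r\<le>Suc m. esym r i * forest m r)" by (rule sibs_alt) simp
  also have "\<dots> = forest m 0 + (\<Sum>r\<le>m. esym (Suc r) i * forest m (Suc r))"
    unfolding sum.atMost_Suc_shift by simp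
  also have "\<dots> = (forest m 0 + (\<Sum>r\<le>m. esym (Suc r) (Suc i) * forest m (Suc r))) + \<theta> i * (\<Sum>r\<le>m. esym r (Suc i) * forest m (1 + r))"
    by (subst esym_step) (simp add: algebra_simps sum.distrib sum_distrib_left)
  also have "forest m 0 + (\<Sum>r\<le>m. esym (Suc r) (Suc i) * forest m (Suc r)) = (\<Sum>r\<le>Suc m. esym r (Suc i) * forest m r)"
    unfolding sum.atMost_Suc_shift by simp
  also have "\<dots> = sibs (Suc i) m" by (rule sibs_alt[symmetric]) simp
  also have "(\<Sum>r\<le>m. esym r (Suc i) * forest m (1 + r)) = (\<Sum>k\<le>m. forest k 1 * (\<Sum>r\<le>m. esym r (Suc i) * forest (m - k) r))"
    unfolding forest_add[of m 1] sum_distrib_left by (subst sum.swap) (simp add: mult.left_commute)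
  also have "\<dots> = (\<Sum>k\<le>m. forest k 1 * sibs (Suc i) (m - k))"
    using sibs_alt[of "m - _" m "Suc i"] by simp
  also have "sibs (Suc i) m + \<theta> i * \<dots> = (\<Sum>k\<le>m. (if k = 0 then sibs (Suc i) m else 0)) + (\<Sum>k\<le>m. \<theta> i * forest k 1 * sibs (Suc i) (m - k))"
    by (simp add: sum_distrib_left mult.assoc)
  also have "\<dots> = (\<Sum>k\<le>m. slot i k * sibs (Suc i) (m - k))"
    unfolding sum.distrib[symmetric] by (intro sum.cong) (auto simp: slot_def)
  finally show ?thesis .
qed

section \<open>Log-convexity and ratio inequalities\<close>

text \<open>
  Starting from the children at letters \<open>\<ge> i\<close> of one vertex,
  \<open>n\<close> vertices are explored; the entry is the weight of ending with
  \<open>k\<close> unexplored trees.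
\<close>
primrec sib_row :: "nat \<Rightarrow> nat \<Rightarrow> nat \<Rightarrow> real" where
  "sib_row i 0 = (\<lambda>k. esym k i)"
| "sib_row i (Suc n) = (\<lambda>k. \<Sum>r\<le>Suc k. sib_row i n r * explore r k)"

declare sib_row.simps(2) [simp del]

lemma sib_row_Suc: "k < N \<Longrightarrow> sib_row i (Suc n) k = (\<Sum>r\<le>N. sib_row i n r * explore r k)"
  unfolding sib_row.simps by (intro sum.mono_neutral_left) (auto simp: explore_def)

lemma sib_row_nonneg [simp]: "0 \<le> sib_row i n k"
  by (induction n arbitrary: k) (auto intro!: sum_nonneg simp: sib_row.simps(2))

text \<open>
  The Hankel matrix of \<open>sibs i\<close> is the product of the array \<open>sib_row
  i\<close> and the transpose of \<open>forest\<close>: stop the exploration after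
  \<open>n\<close> of the \<open>n + m\<close> vertices.
\<close>
lemma sib_row_sibs: "(\<Sum>k\<le>m. sib_row i n k * forest m k) = sibs i (n + m)"
proof (induction n arbitrary: m)
  case 0 show ?case by (simp add: sibs_def)
next
  case (Suc n)
  have "(\<Sum>k\<le>m. sib_row i (Suc n) k * forest m k) = (\<Sum>k\<le>m. (\<Sum>r\<le>Suc m. sib_row i n r * explore r k) * forest m k)"
    using sib_row_Suc[of _ "Suc m"] by (intro sum.cong) (auto)
  also have "\<dots> = (\<Sum>r\<le>Suc m. sib_row i n r * (\<Sum>k\<le>m. explore r k * forest m k))"
    unfolding sum_distrib_left sum_distrib_right mult.assoc by (rule sum.swap)
  also have "\<dots> = (\<Sum>r\<le>Suc m. sib_row i n r * forest (Suc m) r)" by (simp add: forest.simps(2))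
  finally show ?case using Suc[of "Suc m"] by simp
qed

text \<open>
  Exploring preserves the order of consecutive rows, as in \<open>forest_lr\<close>. For the
  first two rows the comparison is between the weights of letters \<open>\<ge> i\<close> and
  those of all letters, which is \<open>esym_ratio\<close>.
\<close>
lemma sib_row_lr: "lr_le (sib_row i n) (sib_row i (Suc n))"
proof (induction n)
  case 0
  show ?case unfolding lr_le_def
  proof (intro allI impI)
    \<comment> \<open>The inequality already holds term by term in the sum that defines the next row.\<close>
    fix k l :: nat assume kl: "k < l"
    have "esym l i * explore r k \<le> esym k i * explore r l" if "r \<le> Suc k" for r
    proof (cases "r = 0")
      case False
      have "esym (k + (l - k)) i * esym (Suc k - r) 0 \<le> esym k i * esym ((Suc k - r) + (l - k)) 0"
        using False by (intro esym_ratio) auto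
      moreover have "(Suc k - r) + (l - k) = Suc l - r" using kl that by simp
      ultimately show ?thesis using kl that False by (simp add: explore_def)
    qed (simp add: explore_def)
    then have "(\<Sum>r\<le>Suc k. esym r i * (esym l i * explore r k)) \<le> (\<Sum>r\<le>Suc k. esym r i * (esym k i * explore r l))"
      by (intro sum_mono mult_left_mono) auto
    also have "\<dots> \<le> (\<Sum>r\<le>Suc l. esym r i * (esym k i * explore r l))"
      using kl by (intro sum_mono2) auto
    finally show "sib_row i 0 l * sib_row i (Suc 0) k \<le> sib_row i 0 k * sib_row i (Suc 0) l"
      by (simp add: sib_row.simps(2) sum_distrib_left mult.left_commute)
  qed
next
  case (Suc n)
  show ?case unfolding lr_le_def
  proof (intro allI impI)
    fix k l :: nat assume kl: "k < l"
    then have "lr_le (\<lambda>r. explore r k) (\<lambda>r. explore r l)" using explore_TP2 by (auto simp: lr_le_def mult.commute)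
    from lr_le_sum[OF Suc this, of "Suc l"]
    show "sib_row i (Suc n) l * sib_row i (Suc (Suc n)) k \<le> sib_row i (Suc n) k * sib_row i (Suc (Suc n)) l"
      using sib_row_Suc[of k "Suc l"] sib_row_Suc[of l "Suc l"] kl by simp
  qed
qed

text \<open>
  The rows 0 and 1 of \<open>forest\<close> are unit vectors, so by the factorisation of the
  Hankel matrix the first two columns of \<open>sib_row i\<close> are the sequence
  \<open>sibs i\<close> and its shift. The claim is a minor of these columns.
\<close>
lemma sibs_log_convex_step: "sibs i (Suc n) * sibs i (Suc n) \<le> sibs i n * sibs i (Suc (Suc n))"
proof -
  have "sib_row i n 0 = sibs i n" for n using sib_row_sibs[of i n 0] by simp
  moreover have "sib_row i n 1 = sibs i (Suc n)" for n using sib_row_sibs[of i n 1] by (simp add: sum.atMost_Suc)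
  ultimately show ?thesis using sib_row_lr[of i n] unfolding lr_le_def by (metis zero_less_one)
qed

lemma sibs_log_convex: "log_convex (sibs i)"
  unfolding log_convex_def
proof (intro allI impI)
  fix s t :: nat assume "s \<le> t"
  then show "sibs i (Suc s) * sibs i t \<le> sibs i s * sibs i (Suc t)"
  proof (cases "esym (Suc 0) i = 0")
    case True
    then show ?thesis using sibs_zero by simp
  next
    case False
    then have pos: "0 < sibs i n" for n using sibs_pos esym_nonneg[of "Suc 0" i] by (simp only: less_le) auto
    have "sibs i (Suc s) / sibs i s \<le> sibs i (Suc t) / sibs i t"
      by (rule lift_Suc_mono_le[OF _ \<open>s \<le> t\<close>, of "\<lambda>n. sibs i (Suc n) / sibs i n"])
        (use sibs_log_convex_step pos in \<open>simp add: divide_simps mult.commute\<close>)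
    then show ?thesis using pos[of s] pos[of t] by (simp add: divide_simps mult.commute)
  qed
qed

lemma esym_1_ge: "\<theta> i \<le> esym (Suc 0) i"
  using esym_step[of 0 i] esym_nonneg[of "Suc 0" "Suc i"] by simp

text \<open>
  Up to the factor \<open>\<theta> i\<close> this is the log-convexity of \<open>Z\<close>.
  The entry at index 0 is 1 instead of a multiple of a tree weight, and there
  \<open>\<theta> i\<close> being at most the sum of all weights is what is required.
\<close>
lemma slot_log_convex: "log_convex (slot i)"
  unfolding log_convex_def
proof (intro allI impI)
  fix s t :: nat assume st: "s \<le> t"
  show "slot i (Suc s) * slot i t \<le> slot i s * slot i (Suc t)"
  proof (cases s)
    case 0
    show ?thesis
    proof (cases t)
      case (Suc t')
      have "esym (Suc 0) 0 * sibs 0 t' \<le> sibs 0 (Suc t')"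
        using sibs_log_convex[of 0] sibs_1[of 0] unfolding log_convex_def by (metis sibs_0 le0 mult_1)
      moreover have "\<theta> i * sibs 0 t' \<le> esym (Suc 0) 0 * sibs 0 t'"
        using sum_le_suminf[OF summable, of "{i}"] nonneg by (intro mult_right_mono) (auto simp: esym.simps)
      ultimately show ?thesis unfolding 0 Suc slot_def using nonneg[of i]
        by (simp add: forest_one mult.assoc mult_left_mono)
    qed (use 0 in simp)
  next
    case (Suc s')
    then obtain t' where t: "t = Suc t'" using st by (cases t) auto
    have "sibs 0 (Suc s') * sibs 0 t' \<le> sibs 0 s' * sibs 0 (Suc t')"
      using sibs_log_convex[of 0] Suc t st unfolding log_convex_def by simp
    then have "\<theta> i * \<theta> i * (sibs 0 (Suc s') * sibs 0 t') \<le> \<theta> i * \<theta> i * (sibs 0 s' * sibs 0 (Suc t'))"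
      using nonneg[of i] by (intro mult_left_mono) auto
    then show ?thesis unfolding Suc t slot_def by (simp add: forest_one algebra_simps)
  qed
qed

text \<open>
  The boundary inequality for the later letters: the conditional probability that the letter
  \<open>i\<close> carries no subtree is nonincreasing in the total size. A larger total
  size favours more children in the likelihood ratio order, and more children make it more
  likely that \<open>i\<close> is among their letters.
\<close>
lemma sibs_ratio: "sibs (Suc i) (Suc m) * sibs i m \<le> sibs (Suc i) m * sibs i (Suc m)"
proof -
  have "lr_le (\<lambda>r. esym r (Suc i)) (\<lambda>r. esym r i)"
    unfolding lr_le_def
  proof (intro allI impI)
    fix k l :: nat assume "k < l"
    then show "esym l (Suc i) * esym k i \<le> esym k (Suc i) * esym l i"
      using esym_ratio[of i "Suc i" k k "l - k"] by simp
  qed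
  from lr_le_sum[OF this forest_lr[of m], of "Suc m"] show ?thesis
    using sibs_alt[of m "Suc m"] sibs_alt[of "Suc m" "Suc m"] by simp
qed

text \<open>
  The boundary inequality for the letter \<open>i\<close>: the conditional probability that
  all vertices are in the subtree at \<open>i\<close> is nonincreasing in the total size.
  For positive size it holds for every number \<open>r \<ge> 1\<close> of nonempty siblings
  separately, by \<open>forest_lr\<close>.
\<close>
lemma slot_ratio: "slot i (Suc m) * sibs i m \<le> slot i m * sibs i (Suc m)"
proof (cases m)
  case 0
  then show ?thesis using esym_1_ge[of i] sibs_1[of i] by (simp add: slot_def forest_one)
next
  case (Suc n)
  have "forest (Suc m) 1 * (\<Sum>r\<le>Suc m. esym r i * forest m r) \<le> forest m 1 * (\<Sum>r\<le>Suc m. esym r i * forest (Suc m) r)"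
    unfolding sum_distrib_left
  proof (rule sum_mono)
    fix r
    have "forest m r * forest (Suc m) 1 \<le> forest m 1 * forest (Suc m) r"
      using lr_leD[OF forest_lr[of m], of 1 r] Suc forest_Suc_0[of n] by (cases r) (auto)
    then have "esym r i * (forest m r * forest (Suc m) 1) \<le> esym r i * (forest m 1 * forest (Suc m) r)"
      by (intro mult_left_mono) auto
    then show "forest (Suc m) 1 * (esym r i * forest m r) \<le> forest m 1 * (esym r i * forest (Suc m) r)"
      by (simp only: algebra_simps)
  qed
  then have "forest (Suc m) 1 * sibs i m \<le> forest m 1 * sibs i (Suc m)"
    using sibs_alt[of m "Suc m" i] sibs_alt[of "Suc m" "Suc m" i] by (simp only: le_SucI order_refl)
  then have "\<theta> i * (forest (Suc m) 1 * sibs i m) \<le> \<theta> i * (forest m 1 * sibs i (Suc m))" using nonneg by (intro mult_left_mono)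
  then show ?thesis using Suc by (simp add: slot_def mult.assoc)
qed

end

section \<open>Growing one of two neighbouring sizes\<close>

text \<open>
  The unnormalised distribution function of the first of two sizes with sum
  \<open>m\<close>.
\<close>
definition cum :: "(nat \<Rightarrow> real) \<Rightarrow> (nat \<Rightarrow> real) \<Rightarrow> nat \<Rightarrow> nat \<Rightarrow> real" where
  "cum u v m k = (\<Sum>j\<le>k. u j * v (m - j))"

lemma cum_Suc: "cum u v m (Suc k) = cum u v m k + u (Suc k) * v (m - Suc k)"
  by (simp add: cum_def)

lemma cum_0: "cum u v m 0 = u 0 * v m"
  by (simp add: cum_def)

lemma cum_total_swap: "cum u v m m = cum v u m m"
  unfolding cum_def by (rule sum.reindex_bij_witness[of _ "\<lambda>j. m - j" "\<lambda>j. m - j"]) (auto simp: mult.commute)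

lemma cum_complement:
  assumes "k < m"
  shows "cum u v m k + cum v u m (m - Suc k) = cum u v m m"
proof -
  have "cum v u m (m - Suc k) = (\<Sum>j\<in>{Suc k..m}. u j * v (m - j))"
    unfolding cum_def using assms
    by (intro sum.reindex_bij_witness[of _ "\<lambda>j. m - j" "\<lambda>j. m - j"]) (auto simp: mult.commute)
  moreover have "{..m} = {..k} \<union> {Suc k..m}" using assms by auto
  ultimately show ?thesis unfolding cum_def
    by (simp add: sum.union_disjoint)
qed

text \<open>
  The normalised distribution function of the first size does not increase when the total
  grows from \<open>m\<close> to \<open>m + 1\<close>. By log-convexity of \<open>v\<close>
  each term grows by at most the ratio \<open>v (Suc m) / v m\<close> belonging to the term
  \<open>j = 0\<close>, and by assumption this ratio is at most that of the normalisations
  \<open>c\<close>.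
\<close>
lemma cum_monotone:
  assumes "log_convex v" and nonneg: "\<And>j. 0 \<le> u j" "\<And>j. 0 \<le> v j" "\<And>j. 0 \<le> c j"
    and ratio: "v (Suc m) * c m \<le> v m * c (Suc m)"
    and zero: "\<And>j. v m = 0 \<Longrightarrow> 0 < j \<Longrightarrow> v j = 0" and "k \<le> m"
  shows "cum u v (Suc m) k * c m \<le> cum u v m k * c (Suc m)"
proof (cases "v m = 0")
  case True
  then have "cum u v (Suc m) k = 0"
    unfolding cum_def using zero \<open>k \<le> m\<close> by (intro sum.neutral) auto
  then show ?thesis using nonneg by (auto simp: cum_def intro!: mult_nonneg_nonneg sum_nonneg)
next
  case False
  then have pos: "0 < v m" using nonneg(2)[of m] by simp
  have "cum u v (Suc m) k * v m \<le> cum u v m k * v (Suc m)"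
    unfolding cum_def sum_distrib_right
  proof (rule sum_mono)
    fix j assume "j \<in> {..k}"
    then have "v (Suc (m - j)) * v m \<le> v (m - j) * v (Suc m)"
      using assms(1) unfolding log_convex_def by simp
    moreover have "Suc m - j = Suc (m - j)" using \<open>j \<in> {..k}\<close> \<open>k \<le> m\<close> by auto
    ultimately show "u j * v (Suc m - j) * v m \<le> u j * v (m - j) * v (Suc m)"
      using nonneg(1)[of j] by (simp add: mult.assoc mult_left_mono)
  qed
  then have "cum u v (Suc m) k * v m * c m \<le> cum u v m k * v (Suc m) * c m"
    using nonneg(3) by (intro mult_right_mono)
  also have "\<dots> \<le> cum u v m k * (v m * c (Suc m))"
    unfolding mult.assoc using ratio nonneg by (intro mult_left_mono) (auto simp: cum_def intro!: sum_nonneg)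
  finally have "v m * (cum u v (Suc m) k * c m) \<le> v m * (cum u v m k * c (Suc m))"
    by (simp add: ac_simps)
  then show ?thesis using pos by simp
qed

context edge_weights
begin

lemma sibs_cum: "sibs i m = cum (slot i) (sibs (Suc i)) m m"
  unfolding cum_def by (rule sibs_conv)

lemma slot_sibs_le: "slot i k * sibs (Suc i) l \<le> sibs i (k + l)"
  unfolding sibs_conv[of i "k + l"]
  using member_le_sum[of k "{..k + l}" "\<lambda>j. slot i j * sibs (Suc i) (k + l - j)"] by simp

lemma sibs_eq_0_imp: "sibs i m = 0 \<Longrightarrow> 0 < j \<Longrightarrow> sibs i j = 0"
  by (metis sibs_pos sibs_zero esym_nonneg order_le_less order_less_irrefl)

lemma slot_eq_0_imp: "slot i m = 0 \<Longrightarrow> 0 < j \<Longrightarrow> slot i j = 0"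
  using forest_one_pos[of "m - 1"] by (auto simp: slot_def split: if_splits)

text \<open>
  Up to normalisation, the mass that moves from first size \<open>k\<close> to first size
  \<open>k + 1\<close> when the total size grows from \<open>m\<close> to \<open>m +
  1\<close>: as no other mass crosses this level, it is the difference of the two
  distribution functions at \<open>k\<close>.
\<close>
definition up_flow :: "nat \<Rightarrow> nat \<Rightarrow> nat \<Rightarrow> real" where
  "up_flow i m k = cum (slot i) (sibs (Suc i)) m k * sibs i (Suc m) - cum (slot i) (sibs (Suc i)) (Suc m) k * sibs i m"

definition stay_flow :: "nat \<Rightarrow> nat \<Rightarrow> nat \<Rightarrow> real" where
  "stay_flow i m k = slot i k * sibs (Suc i) (m - k) * sibs i (Suc m) - up_flow i m k"

lemma up_flow_nonneg: "k \<le> m \<Longrightarrow> 0 \<le> up_flow i m k"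
  unfolding up_flow_def diff_ge_0_iff_ge
  by (rule cum_monotone[OF sibs_log_convex slot_nonneg sibs_nonneg sibs_nonneg sibs_ratio sibs_eq_0_imp])

text \<open>
  In terms of the second size, which then grows, this is the same statement as
  \<open>up_flow_nonneg\<close> with the roles of the two sequences exchanged.
\<close>
lemma stay_flow_nonneg:
  assumes "k \<le> m" shows "0 \<le> stay_flow i m k"
proof -
  have "cum (sibs (Suc i)) (slot i) (Suc m) (m - k) * sibs i m \<le> cum (sibs (Suc i)) (slot i) m (m - k) * sibs i (Suc m)"
    by (rule cum_monotone[OF slot_log_convex sibs_nonneg slot_nonneg sibs_nonneg slot_ratio slot_eq_0_imp]) simp_all
  moreover have "cum (slot i) (sibs (Suc i)) (Suc m) k + cum (sibs (Suc i)) (slot i) (Suc m) (m - k) = sibs i (Suc m)"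
    using cum_complement[of k "Suc m"] assms by (simp add: sibs_cum[symmetric])
  moreover have "cum (slot i) (sibs (Suc i)) m k - slot i k * sibs (Suc i) (m - k) + cum (sibs (Suc i)) (slot i) m (m - k) = sibs i m"
  proof (cases k)
    case 0
    then show ?thesis using cum_total_swap[of "slot i" "sibs (Suc i)" m] by (simp add: sibs_cum[symmetric] cum_0)
  next
    case (Suc k')
    then show ?thesis using cum_complement[of k' m "slot i" "sibs (Suc i)"] assms by (simp add: sibs_cum[symmetric] cum_Suc)
  qed
  ultimately have "(sibs i (Suc m) - cum (slot i) (sibs (Suc i)) (Suc m) k) * sibs i m
    \<le> (sibs i m - (cum (slot i) (sibs (Suc i)) m k - slot i k * sibs (Suc i) (m - k))) * sibs i (Suc m)"
    by (smt (verit))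
  then show ?thesis unfolding stay_flow_def up_flow_def by (simp add: algebra_simps)
qed

lemma stay_flow_0: "stay_flow i m 0 = sibs (Suc i) (Suc m) * sibs i m"
  by (simp add: stay_flow_def up_flow_def cum_0)

lemma stay_flow_Suc: "stay_flow i m (Suc k) + up_flow i m k = slot i (Suc k) * sibs (Suc i) (m - k) * sibs i m"
  by (simp add: stay_flow_def up_flow_def cum_Suc algebra_simps)

lemma up_flow_last: "up_flow i m m = slot i (Suc m) * sibs i m"
  unfolding up_flow_def sibs_cum[symmetric] using cum_Suc[of "slot i" "sibs (Suc i)" "Suc m" m]
  by (simp add: sibs_cum[symmetric] algebra_simps)

text \<open>
  The probability that the subtree at \<open>i\<close> grows if it has \<open>k\<close>
  vertices and the later ones have \<open>l\<close>. A state of weight 0 gets probability 0.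
\<close>
definition up_here :: "nat \<Rightarrow> nat \<Rightarrow> nat \<Rightarrow> real" where
  "up_here i k l = up_flow i (k + l) k / (slot i k * sibs (Suc i) l * sibs i (Suc (k + l)))"

text \<open>
  The probability of the reverse move: that the subtree at \<open>i\<close> loses a vertex.
  The first two cases are forced, because an empty subtree cannot shrink; for \<open>l =
  0\<close> the general formula gives the same value unless its denominator vanishes.
\<close>
definition down_here :: "nat \<Rightarrow> nat \<Rightarrow> nat \<Rightarrow> real" where
  "down_here i k l = (if k = 0 then 0 else if l = 0 then 1
     else up_flow i (k - 1 + l) (k - 1) / (slot i k * sibs (Suc i) l * sibs i (k - 1 + l)))"

text \<open>
  This covers \<open>x = 0\<close> as well, where both \<open>u\<close> and the quotient are
  0.
\<close>
lemma fraction_of: "0 \<le> u \<Longrightarrow> u \<le> x \<Longrightarrow> 0 \<le> u / x \<and> u / x \<le> 1 \<and> x * (u / x) = (u :: real)"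
  by (cases "x = 0") (auto simp: divide_simps)

lemma up_here_props:
  shows up_here_nonneg: "0 \<le> up_here i k l" and up_here_le_1: "up_here i k l \<le> 1"
    and up_here_flow: "slot i k * sibs (Suc i) l * sibs i (Suc (k + l)) * up_here i k l = up_flow i (k + l) k"
proof -
  have "up_flow i (k + l) k \<le> slot i k * sibs (Suc i) l * sibs i (Suc (k + l))"
    using stay_flow_nonneg[of k "k + l" i] by (simp add: stay_flow_def)
  from fraction_of[OF up_flow_nonneg this]
  show "0 \<le> up_here i k l" "up_here i k l \<le> 1" "slot i k * sibs (Suc i) l * sibs i (Suc (k + l)) * up_here i k l = up_flow i (k + l) k"
    unfolding up_here_def by simp_all
qed

lemma down_here_props:
  shows down_here_nonneg: "0 \<le> down_here i k l" and down_here_le_1: "down_here i k l \<le> 1"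
    and down_here_flow: "slot i (Suc k) * sibs (Suc i) l * sibs i (k + l) * down_here i (Suc k) l = up_flow i (k + l) k"
proof -
  have *: "up_flow i (k + l) k \<le> slot i (Suc k) * sibs (Suc i) l * sibs i (k + l)" if "0 < l" for k l
    using stay_flow_Suc[of i "k + l" k] stay_flow_nonneg[of "Suc k" "k + l" i] that by simp
  have **: "0 \<le> down_here i (Suc k) l \<and> down_here i (Suc k) l \<le> 1 \<and> slot i (Suc k) * sibs (Suc i) l * sibs i (k + l) * down_here i (Suc k) l = up_flow i (k + l) k" for k l
  proof (cases "l = 0")
    case False
    then have "down_here i (Suc k) l = up_flow i (k + l) k / (slot i (Suc k) * sibs (Suc i) l * sibs i (k + l))" by (simp add: down_here_def)
    moreover have "0 \<le> up_flow i (k + l) k" by (rule up_flow_nonneg) simp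
    moreover have "up_flow i (k + l) k \<le> slot i (Suc k) * sibs (Suc i) l * sibs i (k + l)" using * False by simp
    ultimately show ?thesis using fraction_of by presburger
  qed (simp add: down_here_def up_flow_last)
  show "0 \<le> down_here i k l" "down_here i k l \<le> 1" using **[of "k - 1" l] by (cases k; simp add: down_here_def)+
  show "slot i (Suc k) * sibs (Suc i) l * sibs i (k + l) * down_here i (Suc k) l = up_flow i (k + l) k" using ** by simp
qed

text \<open>
  Detailed balance for the move that increases the size at \<open>i\<close>.
\<close>
lemma local_balance_here:
  "slot i k * sibs (Suc i) l * up_here i k l * sibs i (Suc (k + l)) = slot i (Suc k) * sibs (Suc i) l * down_here i (Suc k) l * sibs i (k + l)"
proof -
  have "slot i k * sibs (Suc i) l * sibs i (Suc (k + l)) * up_here i k l = slot i (Suc k) * sibs (Suc i) l * sibs i (k + l) * down_here i (Suc k) l"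
    by (simp only: up_here_flow down_here_flow)
  then show ?thesis by (simp only: mult_ac)
qed

text \<open>
  Detailed balance for the move that increases the total size at later letters.
\<close>
lemma local_balance_later:
  "slot i k * sibs (Suc i) l * (1 - up_here i k l) * sibs i (Suc (k + l)) = slot i k * sibs (Suc i) (Suc l) * (1 - down_here i k (Suc l)) * sibs i (k + l)"
proof -
  have "slot i k * sibs (Suc i) l * (1 - up_here i k l) * sibs i (Suc (k + l)) = stay_flow i (k + l) k"
    using up_here_flow[of i k l] unfolding stay_flow_def by (simp add: algebra_simps)
  also have "\<dots> = slot i k * sibs (Suc i) (Suc l) * (1 - down_here i k (Suc l)) * sibs i (k + l)"
  proof (cases k)
    case 0
    then show ?thesis by (simp add: stay_flow_0 down_here_def)
  next
    case (Suc k')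
    then show ?thesis using stay_flow_Suc[of i "k + l" k'] down_here_flow[of i k' "Suc l"] by (simp add: algebra_simps)
  qed
  finally show ?thesis .
qed

section \<open>Growing a vector of subtree sizes\<close>

text \<open>
  The sum over the finite support avoids fixing a bound on the letters.
\<close>
definition tail :: "(nat \<Rightarrow> nat) \<Rightarrow> nat \<Rightarrow> nat" where
  "tail \<nu> i = (\<Sum>j\<in>{j. i \<le> j \<and> \<nu> j \<noteq> 0}. \<nu> j)"

lemma tail_eq: "\<forall>j\<ge>K. \<nu> j = 0 \<Longrightarrow> tail \<nu> i = (\<Sum>j\<in>{i..<K}. \<nu> j)"
proof -
  assume K: "\<forall>j\<ge>K. \<nu> j = 0"
  have "j < K" if "\<nu> j \<noteq> 0" for j using K that by (metis not_le)
  then show ?thesis unfolding tail_def by (intro sum.mono_neutral_left) auto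
qed

lemma tail_Suc:
  assumes "\<forall>j\<ge>K. \<nu> j = 0" shows "tail \<nu> i = \<nu> i + tail \<nu> (Suc i)"
proof (cases "i < K")
  case True
  then show ?thesis using tail_eq[OF assms, of i] tail_eq[OF assms, of "Suc i"] by (simp add: sum.atLeast_Suc_lessThan)
qed (simp add: tail_eq[OF assms] assms)

lemma tail_upd:
  assumes "\<forall>j\<ge>K. \<nu> j = 0"
  shows "tail (\<nu>(i := Suc (\<nu> i))) j = (if j \<le> i then Suc (tail \<nu> j) else tail \<nu> j)"
proof -
  define L where "L = max K (Suc i)"
  have 1: "tail \<nu> j = (\<Sum>j\<in>{j..<L}. \<nu> j)" using assms by (intro tail_eq) (simp add: L_def)
  have 2: "tail (\<nu>(i := Suc (\<nu> i))) j = (\<Sum>j\<in>{j..<L}. (\<nu>(i := Suc (\<nu> i))) j)" using assms by (intro tail_eq) (simp add: L_def)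
  have "(\<Sum>j\<in>{j..<L}. (\<nu>(i := Suc (\<nu> i))) j) = (\<Sum>j\<in>{j..<L}. \<nu> j + (if j = i then 1 else 0))"
    by (intro sum.cong) auto
  then show ?thesis unfolding 1 2 by (auto simp: sum.distrib L_def)
qed

text \<open>
  The probability that the decision where to grow passes all letters below \<open>i\<close>.
\<close>
definition up_pass :: "(nat \<Rightarrow> nat) \<Rightarrow> nat \<Rightarrow> real" where
  "up_pass \<nu> i = (\<Prod>j<i. 1 - up_here j (\<nu> j) (tail \<nu> (Suc j)))"

text \<open>
  The probability that growth happens at the letter \<open>i\<close>.
\<close>
definition up :: "(nat \<Rightarrow> nat) \<Rightarrow> nat \<Rightarrow> real" where
  "up \<nu> i = up_pass \<nu> i * up_here i (\<nu> i) (tail \<nu> (Suc i))"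

definition down_pass :: "(nat \<Rightarrow> nat) \<Rightarrow> nat \<Rightarrow> real" where
  "down_pass \<nu> i = (\<Prod>j<i. 1 - down_here j (\<nu> j) (tail \<nu> (Suc j)))"

definition down :: "(nat \<Rightarrow> nat) \<Rightarrow> nat \<Rightarrow> real" where
  "down \<nu> i = down_pass \<nu> i * down_here i (\<nu> i) (tail \<nu> (Suc i))"

lemma up_pass_bounds: "0 \<le> up_pass \<nu> i" "up_pass \<nu> i \<le> 1"
  unfolding up_pass_def by (auto intro!: prod_nonneg prod_le_1 simp: up_here_le_1 up_here_nonneg)

lemma up_nonneg: "0 \<le> up \<nu> i" by (simp add: up_def up_pass_bounds up_here_nonneg)

lemma sum_up: "(\<Sum>i<I. up \<nu> i) = 1 - up_pass \<nu> I"
  by (induction I) (simp_all add: up_def up_pass_def right_diff_distrib)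

lemma sum_down: "(\<Sum>i<I. down \<nu> i) = 1 - down_pass \<nu> I"
  by (induction I) (simp_all add: down_def down_pass_def right_diff_distrib)

text \<open>
  Two balance equations can be multiplied, and the common factors \<open>c\<close> and
  \<open>c'\<close> cancelled, even if they vanish, provided that they dominate
  \<open>s\<close> and \<open>t\<close>.
\<close>
lemma balance_transfer:
  fixes X Y C C' s t c c' :: real
  assumes "X * c * C' = Y * c' * C" "s * c' = t * c" "c = 0 \<Longrightarrow> s = 0" "c' = 0 \<Longrightarrow> t = 0"
  shows "X * s * C' = Y * t * C"
proof (cases "c = 0 \<or> c' = 0")
  case True
  then show ?thesis using assms by (cases "c = 0"; cases "c' = 0") auto
next
  case False
  have "c * (c' * (X * s * C')) = (X * c * C') * (s * c')" by (simp only: mult_ac)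
  also have "\<dots> = (Y * c' * C) * (t * c)" by (simp only: assms(1,2))
  also have "\<dots> = c * (c' * (Y * t * C))" by (simp only: mult_ac)
  finally show ?thesis using False by simp
qed

lemma slot_sibs_zero: "sibs i (k + l) = 0 \<Longrightarrow> slot i k * sibs (Suc i) l = 0"
  using slot_sibs_le[of i k l] mult_nonneg_nonneg[OF slot_nonneg[of i k] sibs_nonneg[of "Suc i" l]] by linarith

text \<open>
  The local balance equations for the letters below \<open>i\<close>, multiplied together:
  each step replaces the weight of all siblings from one letter on by the weight of the
  subtree at that letter and of the siblings after it.
\<close>
lemma pass_balance:
  assumes K: "\<forall>j\<ge>K. \<nu> j = 0"
  shows "(\<Prod>j<i. slot j (\<nu> j)) * up_pass \<nu> i * sibs i (tail \<nu> i) * sibs 0 (Suc (tail \<nu> 0)) =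
     (\<Prod>j<i. slot j (\<nu> j)) * (\<Prod>j<i. 1 - down_here j (\<nu> j) (Suc (tail \<nu> (Suc j)))) * sibs i (Suc (tail \<nu> i)) * sibs 0 (tail \<nu> 0)"
proof (induction i)
  case 0
  show ?case by (simp add: up_pass_def)
next
  case (Suc i)
  let ?k = "\<nu> i" and ?l = "tail \<nu> (Suc i)"
  have t: "tail \<nu> i = ?k + ?l" by (rule tail_Suc[OF K])
  from balance_transfer[OF Suc[unfolded t] local_balance_later[of i ?k ?l]]
  show ?case
    using slot_sibs_zero[of i ?k ?l] slot_sibs_zero[of i ?k "Suc ?l"]
    by (simp add: up_pass_def mult_ac)
qed

text \<open>
  A single size vector contributes at most the total weight of its size.
\<close>
lemma prod_slot_le:
  assumes K: "\<forall>j\<ge>K. \<nu> j = 0" and "i \<le> K"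
  shows "(\<Prod>j\<in>{i..<K}. slot j (\<nu> j)) \<le> sibs i (tail \<nu> i)"
  using \<open>i \<le> K\<close>
proof (induction i rule: inc_induct)
  case base
  then show ?case by (simp add: tail_eq[OF K])
next
  case (step i)
  have "(\<Prod>j\<in>{i..<K}. slot j (\<nu> j)) = slot i (\<nu> i) * (\<Prod>j\<in>{Suc i..<K}. slot j (\<nu> j))"
    using step by (simp add: prod.atLeast_Suc_lessThan)
  also have "\<dots> \<le> slot i (\<nu> i) * sibs (Suc i) (tail \<nu> (Suc i))"
    using step by (intro mult_left_mono) auto
  also have "\<dots> \<le> sibs i (tail \<nu> i)" unfolding tail_Suc[OF K, of i] by (rule slot_sibs_le)
  finally show ?case .
qed

text \<open>
  Detailed balance on size vectors: the letters below \<open>i\<close> contribute by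
  \<open>pass_balance\<close>, the letter \<open>i\<close> by
  \<open>local_balance_here\<close>, and the later ones are unchanged.
\<close>
lemma up_down_balance:
  assumes K: "\<forall>j\<ge>K. \<nu> j = 0" and "i < K"
  shows "(\<Prod>j\<in>{..<K} - {i}. slot j (\<nu> j)) * slot i (\<nu> i) * up \<nu> i * sibs 0 (Suc (tail \<nu> 0)) =
     (\<Prod>j\<in>{..<K} - {i}. slot j (\<nu> j)) * slot i (Suc (\<nu> i)) * down (\<nu>(i := Suc (\<nu> i))) i * sibs 0 (tail \<nu> 0)"
proof -
  let ?k = "\<nu> i" and ?l = "tail \<nu> (Suc i)"
  let ?P = "\<Prod>j<i. slot j (\<nu> j)" and ?R = "\<Prod>j\<in>{Suc i..<K}. slot j (\<nu> j)"
  have split: "(\<Prod>j\<in>{..<K} - {i}. slot j (\<nu> j)) = ?P * ?R"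
  proof -
    have "{..<K} - {i} = {..<i} \<union> {Suc i..<K}" using \<open>i < K\<close> by auto
    moreover have "(\<Prod>j\<in>{..<i} \<union> {Suc i..<K}. slot j (\<nu> j)) = ?P * ?R" by (intro prod.union_disjoint) auto
    ultimately show ?thesis by simp
  qed
  let ?S = "\<Prod>j<i. 1 - down_here j (\<nu> j) (Suc (tail \<nu> (Suc j)))"
  \<comment> \<open>Before the letter \<open>i\<close> the new vector differs from the old one only in the
      sizes of the tails.\<close>
  have dn: "down (\<nu>(i := Suc (\<nu> i))) i = ?S * down_here i (Suc ?k) ?l"
    unfolding down_def down_pass_def using tail_upd[OF K, of i] by simp
  have "?P * up_pass \<nu> i * (slot i ?k * sibs (Suc i) ?l * up_here i ?k ?l) * sibs 0 (Suc (tail \<nu> 0)) =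
     ?P * ?S * (slot i (Suc ?k) * sibs (Suc i) ?l * down_here i (Suc ?k) ?l) * sibs 0 (tail \<nu> 0)"
    using pass_balance[OF K, of i] local_balance_here[of i ?k ?l] unfolding tail_Suc[OF K, of i]
    by (rule balance_transfer) (use slot_sibs_zero[of i ?k ?l] slot_sibs_zero[of i "Suc ?k" ?l] in auto)
  then have *: "sibs (Suc i) ?l * (?P * slot i ?k * up \<nu> i * sibs 0 (Suc (tail \<nu> 0))) =
     sibs (Suc i) ?l * (?P * slot i (Suc ?k) * (?S * down_here i (Suc ?k) ?l) * sibs 0 (tail \<nu> 0))"
    unfolding up_def by (simp only: mult_ac)
  show ?thesis
  proof (cases "?R = 0")
    case False
    moreover have "0 \<le> ?R" by (intro prod_nonneg) auto
    moreover have "?R \<le> sibs (Suc i) ?l" using \<open>i < K\<close> by (intro prod_slot_le[OF K]) simp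
    ultimately have "0 < sibs (Suc i) ?l" by linarith
    with * have "?P * slot i ?k * up \<nu> i * sibs 0 (Suc (tail \<nu> 0)) = ?P * slot i (Suc ?k) * (?S * down_here i (Suc ?k) ?l) * sibs 0 (tail \<nu> 0)"
      by simp
    then have "?R * (?P * slot i ?k * up \<nu> i * sibs 0 (Suc (tail \<nu> 0))) = ?R * (?P * slot i (Suc ?k) * (?S * down_here i (Suc ?k) ?l) * sibs 0 (tail \<nu> 0))"
      by (rule arg_cong)
    then show ?thesis unfolding split dn by (simp only: mult_ac)
  qed (simp add: split)
qed

text \<open>
  Growth cannot be postponed for ever: beyond the support of \<open>\<nu>\<close>, the
  balance equation bounds the probability of having passed all letters below
  \<open>i\<close> by a multiple of \<open>\<theta>\<^sub>i + \<theta>\<^bsub>i+1\<^esub> +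
  \<dots>\<close>.
\<close>
lemma up_sums_1:
  assumes K: "\<forall>j\<ge>K. \<nu> j = 0" and pos: "\<And>j. 0 < slot j (\<nu> j)"
  shows "up \<nu> sums 1"
proof -
  let ?m = "tail \<nu> 0"
  have le: "up_pass \<nu> i \<le> esym (Suc 0) i * (sibs 0 ?m / sibs 0 (Suc ?m))" if "K \<le> i" for i
  proof -
    have t: "tail \<nu> i = 0" using that K by (simp add: tail_def)
    let ?S = "\<Prod>j<i. 1 - down_here j (\<nu> j) (Suc (tail \<nu> (Suc j)))" and ?P = "\<Prod>j<i. slot j (\<nu> j)"
    have "?S \<le> 1" by (intro prod_le_1) (auto simp: down_here_le_1 down_here_nonneg)
    have P: "?P \<noteq> 0" using pos by (simp add: less_imp_neq[symmetric])
    have "?P * (up_pass \<nu> i * sibs 0 (Suc ?m)) = ?P * (?S * (esym (Suc 0) i * sibs 0 ?m))"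
      using pass_balance[OF K, of i] unfolding t sibs_1 by (simp add: mult_ac)
    then have "up_pass \<nu> i * sibs 0 (Suc ?m) = ?S * (esym (Suc 0) i * sibs 0 ?m)"
      by (rule mult_left_cancel[OF P, THEN iffD1])
    also have "\<dots> \<le> 1 * (esym (Suc 0) i * sibs 0 ?m)" using \<open>?S \<le> 1\<close> by (intro mult_right_mono) auto
    finally show ?thesis using sibs_0_pos[of "Suc ?m"] by (simp add: field_simps)
  qed
  have "(\<lambda>i. esym (Suc 0) i * (sibs 0 ?m / sibs 0 (Suc ?m))) \<longlonglongrightarrow> 0 * (sibs 0 ?m / sibs 0 (Suc ?m))"
    by (intro tendsto_intros esym_tendsto_0)
  then have lim: "(\<lambda>i. esym (Suc 0) i * (sibs 0 ?m / sibs 0 (Suc ?m))) \<longlonglongrightarrow> 0" by simp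
  have "\<forall>\<^sub>F i in sequentially. up_pass \<nu> i \<le> esym (Suc 0) i * (sibs 0 ?m / sibs 0 (Suc ?m))"
    using le eventually_sequentially by blast
  then have "up_pass \<nu> \<longlonglongrightarrow> 0"
    by (intro tendsto_sandwich[OF _ _ tendsto_const lim]) (simp_all add: up_pass_bounds)
  then have "(\<lambda>I. 1 - up_pass \<nu> I) \<longlonglongrightarrow> 1"
    using tendsto_diff[OF tendsto_const[of 1 sequentially], of "up_pass \<nu>" 0] by simp
  then show ?thesis unfolding sums_def sum_up by simp
qed

text \<open>
  At the last nonempty subtree the vertex has to be removed there.
\<close>
lemma down_sum_1:
  assumes K: "\<forall>j\<ge>K. \<nu> j = 0" and nz: "\<nu> j \<noteq> 0"
  shows "(\<Sum>i<K. down \<nu> i) = 1"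
proof -
  obtain J where J: "\<nu> J \<noteq> 0" "\<And>j. J < j \<Longrightarrow> \<nu> j = 0"
  proof -
    have "j < K" if "\<nu> j \<noteq> 0" for j using K that by (metis not_le)
    then have "{j. \<nu> j \<noteq> 0} \<subseteq> {..<K}" by blast
    then have fin: "finite {j. \<nu> j \<noteq> 0}" by (rule finite_subset[of _ "{..<K}"]) auto
    show ?thesis
    proof (rule that)
      show "\<nu> (Max {j. \<nu> j \<noteq> 0}) \<noteq> 0" using Max_in[OF fin] nz by auto
      show "\<nu> j = 0" if "Max {j. \<nu> j \<noteq> 0} < j" for j
        using Max_ge[OF fin, of j] that by (metis mem_Collect_eq not_le)
    qed
  qed
  have "J < K" using J(1) K by (metis not_le)
  have "tail \<nu> (Suc J) = 0" unfolding tail_def using J(2) by auto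
  then have "1 - down_here J (\<nu> J) (tail \<nu> (Suc J)) = 0" using J by (simp add: down_here_def)
  then have "down_pass \<nu> K = 0" unfolding down_pass_def using \<open>J < K\<close> by (intro prod_zero) auto
  then show ?thesis by (simp add: sum_down)
qed

lemma down_eq_0: "\<nu> i = 0 \<Longrightarrow> down \<nu> i = 0"
  by (simp add: down_def down_here_def)

end

section \<open>Trees as sets of words\<close>

text \<open>
  The empty set is included: it is what is found at a letter without a child. Since words
  are over all natural numbers, membership in the Ulam-Harris tree has to come from
  positivity of the weight.
\<close>
definition word_tree :: "nat list set \<Rightarrow> bool" where
  "word_tree \<tau> \<longleftrightarrow> finite \<tau> \<and> (\<forall>u i. u @ [i] \<in> \<tau> \<longrightarrow> u \<in> \<tau>)"

definition branch :: "nat list set \<Rightarrow> nat \<Rightarrow> nat list set" where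
  "branch \<tau> i = {w. i # w \<in> \<tau>}"

definition sizes :: "nat list set \<Rightarrow> nat \<Rightarrow> nat" where
  "sizes \<tau> i = card (branch \<tau> i)"

lemma word_tree_Nil: "word_tree \<tau> \<Longrightarrow> \<tau> \<noteq> {} \<Longrightarrow> [] \<in> \<tau>"
proof -
  assume t: "word_tree \<tau>" "\<tau> \<noteq> {}"
  have "u \<in> \<tau> \<Longrightarrow> [] \<in> \<tau>" for u
    by (induction u rule: rev_induct) (use t(1) in \<open>auto simp: word_tree_def\<close>)
  then show ?thesis using t(2) by blast
qed

lemma finite_branch: "finite \<tau> \<Longrightarrow> finite (branch \<tau> i)"
  unfolding branch_def by (rule finite_imageD[of "(#) i"]) (auto elim: finite_subset[rotated])

lemma word_tree_branch: "word_tree \<tau> \<Longrightarrow> word_tree (branch \<tau> i)"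
  using finite_branch[of \<tau> i] unfolding word_tree_def branch_def by (metis Cons_eq_appendI mem_Collect_eq)

lemma branch_bound: "finite \<tau> \<Longrightarrow> \<exists>K. i < K \<and> (\<forall>j\<ge>K. branch \<tau> j = {})"
proof -
  assume "finite \<tau>"
  then have fin: "finite (hd ` \<tau>)" by simp
  show ?thesis
  proof (intro exI conjI allI impI)
    show "i < Suc (max i (Max (hd ` \<tau>)))" by simp
    fix j assume j: "Suc (max i (Max (hd ` \<tau>))) \<le> j"
    have False if "j # w \<in> \<tau>" for w
      using Max_ge[OF fin, of j] j that by force
    then show "branch \<tau> j = {}" by (auto simp: branch_def)
  qed
qed

lemma tree_decomp:
  assumes "\<forall>j\<ge>K. branch \<tau> j = {}"
  shows "\<tau> - {[]} = (\<lambda>(i, w). i # w) ` (SIGMA i:{..<K}. branch \<tau> i)"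
proof (intro set_eqI iffI)
  fix u assume "u \<in> \<tau> - {[]}"
  then obtain i w where u: "u = i # w" "w \<in> branch \<tau> i" by (cases u) (auto simp: branch_def)
  moreover have "i < K" using u(2) assms by (metis empty_iff not_le)
  ultimately show "u \<in> (\<lambda>(i, w). i # w) ` (SIGMA i:{..<K}. branch \<tau> i)" by force
qed (auto simp: branch_def)

lemma inj_on_Cons_pair: "inj_on (\<lambda>(i, w). i # w) A"
  by (auto simp: inj_on_def)

lemma prod_tree:
  assumes "finite \<tau>" "\<forall>j\<ge>K. branch \<tau> j = {}"
  shows "prod g (\<tau> - {[]}) = (\<Prod>i<K. \<Prod>w\<in>branch \<tau> i. g (i # w))"
  unfolding tree_decomp[OF assms(2)] prod.reindex[OF inj_on_Cons_pair]
  by (subst prod.Sigma) (auto simp: finite_branch assms(1) intro!: prod.cong)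

lemma sum_tree:
  assumes "finite \<tau>" "\<forall>j\<ge>K. branch \<tau> j = {}"
  shows "sum g (\<tau> - {[]}) = (\<Sum>i<K. \<Sum>w\<in>branch \<tau> i. g (i # w))"
  unfolding tree_decomp[OF assms(2)] sum.reindex[OF inj_on_Cons_pair]
  by (subst sum.Sigma) (auto simp: finite_branch assms(1) intro!: sum.cong)

lemma card_branch_less:
  assumes "word_tree \<tau>" "\<tau> \<noteq> {}"
  shows "card (branch \<tau> i) < card \<tau>"
proof -
  have fin: "finite \<tau>" using assms by (simp add: word_tree_def)
  have "card (branch \<tau> i) = card ((#) i ` branch \<tau> i)" by (simp add: card_image)
  also have "\<dots> < card \<tau>"
    using word_tree_Nil[OF assms] fin by (intro psubset_card_mono) (auto simp: branch_def)
  finally show ?thesis .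
qed

lemma sizes_bound: "\<forall>j\<ge>K. branch \<tau> j = {} \<Longrightarrow> \<forall>j\<ge>K. sizes \<tau> j = 0"
  by (simp add: sizes_def)

lemma branch_insert: "branch (insert (i # w) \<tau>) j = (if j = i then insert w (branch \<tau> i) else branch \<tau> j)"
  by (auto simp: branch_def)

lemma word_tree_singleton: "word_tree {[]}" by (simp add: word_tree_def)

context edge_weights
begin

text \<open>
  The total of the size vector does not count the root.
\<close>
lemma card_tree:
  assumes "word_tree \<tau>" "\<tau> \<noteq> {}"
  shows "card \<tau> = Suc (tail (sizes \<tau>) 0)"
proof -
  have fin: "finite \<tau>" using assms by (simp add: word_tree_def)
  obtain K where K: "\<forall>j\<ge>K. branch \<tau> j = {}" using branch_bound[OF fin] by blast
  have "card \<tau> = Suc (card (\<tau> - {[]}))"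
    by (rule card.remove[OF fin word_tree_Nil[OF assms]])
  also have "card (\<tau> - {[]}) = (\<Sum>u\<in>\<tau> - {[]}. 1)" by simp
  also have "\<dots> = (\<Sum>i<K. sizes \<tau> i)" unfolding sum_tree[OF fin K] by (simp add: sizes_def)
  also have "\<dots> = tail (sizes \<tau>) 0" using tail_eq[OF sizes_bound[OF K], of 0] by (simp add: atLeast0LessThan)
  finally show ?thesis .
qed

definition wt :: "nat list set \<Rightarrow> real" where
  "wt \<tau> = (\<Prod>u\<in>\<tau> - {[]}. \<theta> (last u))"

text \<open>
  The probability of a tree among those with the same number of vertices. The empty tree has
  probability 1.
\<close>
definition norm_wt :: "nat list set \<Rightarrow> real" where
  "norm_wt \<tau> = (if \<tau> = {} then 1 else wt \<tau> / sibs 0 (card \<tau> - 1))"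

lemma wt_nonneg: "0 \<le> wt \<tau>" unfolding wt_def by (intro prod_nonneg) (auto simp: nonneg)

lemma wt_pos_iff: "finite \<tau> \<Longrightarrow> 0 < wt \<tau> \<longleftrightarrow> (\<forall>u\<in>\<tau> - {[]}. 0 < \<theta> (last u))"
  using nonneg by (auto simp: wt_def less_le prod_nonneg)

text \<open>
  The weight of a tree is the weight of its size vector times the conditional probabilities
  of its branches.
\<close>
lemma wt_branches:
  assumes "word_tree \<tau>" and K: "\<forall>j\<ge>K. branch \<tau> j = {}"
  shows "wt \<tau> = (\<Prod>i<K. slot i (sizes \<tau> i) * norm_wt (branch \<tau> i))"
proof -
  have fin: "finite \<tau>" using assms by (simp add: word_tree_def)
  show ?thesis unfolding wt_def prod_tree[OF fin K]
  proof (rule prod.cong)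
    fix i assume "i \<in> {..<K}"
    show "(\<Prod>w\<in>branch \<tau> i. \<theta> (last (i # w))) = slot i (sizes \<tau> i) * norm_wt (branch \<tau> i)"
    proof (cases "branch \<tau> i = {}")
      case True
      then show ?thesis by (simp add: sizes_def norm_wt_def)
    next
      case False
      have finb: "finite (branch \<tau> i)" using fin by (rule finite_branch)
      then obtain m where m: "card (branch \<tau> i) = Suc m" using False by (metis card_eq_0_iff not0_implies_Suc)
      have "(\<Prod>w\<in>branch \<tau> i. \<theta> (last (i # w))) = \<theta> i * (\<Prod>w\<in>branch \<tau> i - {[]}. \<theta> (last (i # w)))"
        by (subst prod.remove[OF finb word_tree_Nil[OF word_tree_branch[OF assms(1)] False]]) simp
      also have "(\<Prod>w\<in>branch \<tau> i - {[]}. \<theta> (last (i # w))) = wt (branch \<tau> i)"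
        unfolding wt_def by (intro prod.cong) auto
      finally show ?thesis using False sibs_0_pos[of m] by (simp add: slot_def norm_wt_def sizes_def m forest_one)
    qed
  qed simp
qed

section \<open>Adding and deleting a leaf\<close>

text \<open>
  The probability that the recursive growth of a tree adds the given word: at each vertex on
  the way the next letter is chosen according to the sizes of the branches, and the first
  empty place is filled.
\<close>
primrec add_prob :: "nat list \<Rightarrow> nat list set \<Rightarrow> real" where
  "add_prob [] = (\<lambda>\<tau>. if \<tau> = {} then 1 else 0)"
| "add_prob (i # w) = (\<lambda>\<tau>. if \<tau> = {} then 0 else up (sizes \<tau>) i * add_prob w (branch \<tau> i))"

text \<open>
  The reverse: descend by the letters chosen according to \<open>down\<close> and delete the
  leaf that is reached.
\<close>
primrec del_prob :: "nat list \<Rightarrow> nat list set \<Rightarrow> real" where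
  "del_prob [] = (\<lambda>\<tau>. if \<tau> = {[]} then 1 else 0)"
| "del_prob (i # w) = (\<lambda>\<tau>. down (sizes \<tau>) i * del_prob w (branch \<tau> i))"

lemma add_prob_nonneg: "0 \<le> add_prob v \<tau>"
  by (induction v arbitrary: \<tau>) (auto simp: up_nonneg)

text \<open>
  Induction along the word: the weights factor over the branches, the branch that is entered
  is handled by the induction hypothesis, and the size vector by
  \<open>up_down_balance\<close>.
\<close>
lemma detailed_balance:
  assumes "word_tree \<tau>" "v \<notin> \<tau>" "word_tree (insert v \<tau>)"
  shows "norm_wt \<tau> * add_prob v \<tau> = norm_wt (insert v \<tau>) * del_prob v (insert v \<tau>)"
  using assms
proof (induction v arbitrary: \<tau>)
  case Nil
  then have "\<tau> = {}" using word_tree_Nil by blast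
  then show ?case by (simp add: norm_wt_def wt_def)
next
  case (Cons i w)
  let ?\<tau>' = "insert (i # w) \<tau>" and ?\<nu> = "sizes \<tau>"
  have Nil: "[] \<in> \<tau>" using word_tree_Nil[OF Cons.prems(3)] by auto
  have fin: "finite ?\<tau>'" using Cons.prems by (simp add: word_tree_def)
  obtain K where K: "i < K" "\<forall>j\<ge>K. branch ?\<tau>' j = {}" using branch_bound[OF fin] by blast
  then have K': "\<forall>j\<ge>K. branch \<tau> j = {}" by (auto simp: branch_def)
  have w: "w \<notin> branch \<tau> i" using Cons.prems by (simp add: branch_def)
  have finb: "finite (branch \<tau> i)" using fin by (intro finite_branch) simp
  have sz: "sizes ?\<tau>' = ?\<nu>(i := Suc (?\<nu> i))"
    using w finb by (auto simp: sizes_def branch_insert fun_eq_iff)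
  have IH: "norm_wt (branch \<tau> i) * add_prob w (branch \<tau> i) = norm_wt (insert w (branch \<tau> i)) * del_prob w (insert w (branch \<tau> i))"
    using word_tree_branch[OF Cons.prems(3), of i] word_tree_branch[OF Cons.prems(1)] w
    by (intro Cons.IH) (simp_all add: branch_insert)
  let ?m = "tail ?\<nu> 0"
  have c: "card \<tau> = Suc ?m" using Nil by (intro card_tree Cons.prems) auto
  then have c': "card ?\<tau>' = Suc (Suc ?m)" using fin Cons.prems by simp
  \<comment> \<open>The factors of the two weights that belong to the other branches agree.\<close>
  let ?Q = "\<Prod>j\<in>{..<K} - {i}. slot j (?\<nu> j)" and ?R = "\<Prod>j\<in>{..<K} - {i}. norm_wt (branch \<tau> j)"
  have wt1: "wt \<tau> = slot i (?\<nu> i) * norm_wt (branch \<tau> i) * (?Q * ?R)"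
    unfolding wt_branches[OF Cons.prems(1) K'] using K
    by (subst prod.remove[of _ i]) (auto simp: prod.distrib)
  have "(\<Prod>j\<in>{..<K} - {i}. slot j (sizes ?\<tau>' j) * norm_wt (branch ?\<tau>' j)) = ?Q * ?R"
    unfolding prod.distrib[symmetric] sz branch_insert by (intro prod.cong) auto
  then have wt2: "wt ?\<tau>' = slot i (Suc (?\<nu> i)) * norm_wt (insert w (branch \<tau> i)) * (?Q * ?R)"
    unfolding wt_branches[OF Cons.prems(3) K(2)] using K
    by (subst prod.remove[of _ i]) (auto simp: sz branch_insert)
  have bal: "?Q * slot i (?\<nu> i) * up ?\<nu> i * sibs 0 (Suc ?m) = ?Q * slot i (Suc (?\<nu> i)) * down (sizes ?\<tau>') i * sibs 0 ?m"
    unfolding sz by (rule up_down_balance[OF sizes_bound[OF K'] K(1)])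
  have "sibs 0 (Suc ?m) * (wt \<tau> * (up ?\<nu> i * add_prob w (branch \<tau> i)))
     = (?Q * slot i (?\<nu> i) * up ?\<nu> i * sibs 0 (Suc ?m)) * ?R * (norm_wt (branch \<tau> i) * add_prob w (branch \<tau> i))"
    unfolding wt1 by (simp only: mult_ac)
  also have "\<dots> = sibs 0 ?m * (wt ?\<tau>' * (down (sizes ?\<tau>') i * del_prob w (insert w (branch \<tau> i))))"
    unfolding wt2 bal IH by (simp only: mult_ac)
  finally have "sibs 0 (Suc ?m) * (wt \<tau> * add_prob (i # w) \<tau>) = sibs 0 ?m * (wt ?\<tau>' * del_prob (i # w) ?\<tau>')"
    using Nil by (auto simp: branch_insert)
  moreover have "norm_wt \<tau> = wt \<tau> / sibs 0 ?m" using Nil c by (auto simp: norm_wt_def)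
  moreover have "norm_wt ?\<tau>' = wt ?\<tau>' / sibs 0 (Suc ?m)" unfolding norm_wt_def c' by simp
  ultimately show ?case using sibs_0_pos[of ?m] sibs_0_pos[of "Suc ?m"]
    by (simp add: frac_eq_eq mult_ac del: add_prob.simps del_prob.simps)
qed

lemma wt_pos_branch:
  assumes "word_tree \<tau>" "0 < wt \<tau>"
  shows "0 < wt (branch \<tau> i)" "branch \<tau> i \<noteq> {} \<Longrightarrow> 0 < \<theta> i"
proof -
  have fin: "finite \<tau>" using assms by (simp add: word_tree_def)
  have pos: "0 < \<theta> (last u)" if "u \<in> \<tau> - {[]}" for u using assms(2) that wt_pos_iff[OF fin] by blast
  show "0 < wt (branch \<tau> i)"
    unfolding wt_pos_iff[OF finite_branch[OF fin]]
  proof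
    fix u assume "u \<in> branch \<tau> i - {[]}"
    then show "0 < \<theta> (last u)" using pos[of "i # u"] by (auto simp: branch_def)
  qed
  show "0 < \<theta> i" if "branch \<tau> i \<noteq> {}"
    using pos[of "[i]"] word_tree_Nil[OF word_tree_branch[OF assms(1)] that] by (simp add: branch_def)
qed

lemma nn_integral_lists_Cons:
  fixes g :: "nat list \<Rightarrow> ennreal"
  assumes "g [] = 0"
  shows "(\<integral>\<^sup>+v. g v \<partial>count_space UNIV) = (\<integral>\<^sup>+i. \<integral>\<^sup>+w. g (i # w) \<partial>count_space UNIV \<partial>count_space UNIV)"
proof -
  let ?c = "\<lambda>(i, w). i # w :: nat list"
  have range: "range ?c = - {[]}" by (auto simp: image_iff) (metis list.exhaust)
  have "(\<integral>\<^sup>+i. \<integral>\<^sup>+w. g (i # w) \<partial>count_space UNIV \<partial>count_space UNIV) = (\<integral>\<^sup>+x. g (?c x) \<partial>count_space UNIV)"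
    using nn_integral_fst_count_space[of "\<lambda>x. g (?c x)"] by simp
  also have "\<dots> = (\<integral>\<^sup>+v. g v \<partial>count_space (- {[]}))"
    by (intro nn_integral_bij_count_space) (metis inj_on_Cons_pair inj_on_imp_bij_betw range)
  also have "\<dots> = (\<integral>\<^sup>+v. g v \<partial>count_space UNIV)"
    using assms by (intro nn_integral_count_space_eq) auto
  finally show ?thesis ..
qed

text \<open>
  By induction on the size of the tree, since branches are smaller than the tree and have
  positive weight too.
\<close>
lemma add_prob_total:
  assumes "word_tree \<tau>" "0 < wt \<tau>"
  shows "(\<integral>\<^sup>+v. ennreal (add_prob v \<tau>) \<partial>count_space UNIV) = 1"
  using assms
proof (induction "card \<tau>" arbitrary: \<tau> rule: less_induct)
  case less
  show ?case
  proof (cases "\<tau> = {}")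
    case True
    have "add_prob v \<tau> = indicator {[]} v" for v by (cases v) (auto simp: True)
    then show ?thesis by (simp add: ennreal_indicator)
  next
    case False
    have fin: "finite \<tau>" using less.prems by (simp add: word_tree_def)
    obtain K where K: "\<forall>j\<ge>K. branch \<tau> j = {}" using branch_bound[OF fin] by blast
    have "0 < slot j (sizes \<tau> j)" for j
    proof (cases "branch \<tau> j = {}")
      case False
      then obtain m where "sizes \<tau> j = Suc m"
        using finite_branch[OF fin] unfolding sizes_def by (metis card_eq_0_iff not0_implies_Suc)
      then show ?thesis using wt_pos_branch(2)[OF less.prems False] forest_one_pos[of m] by (simp add: slot_def)
    qed (simp add: sizes_def)
    then have up: "up (sizes \<tau>) sums 1" by (intro up_sums_1[OF sizes_bound[OF K]])
    have "(\<integral>\<^sup>+v. ennreal (add_prob v \<tau>) \<partial>count_space UNIV)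
      = (\<integral>\<^sup>+i. \<integral>\<^sup>+w. ennreal (up (sizes \<tau>) i) * ennreal (add_prob w (branch \<tau> i)) \<partial>count_space UNIV \<partial>count_space UNIV)"
      using False by (subst nn_integral_lists_Cons) (simp_all add: ennreal_mult up_nonneg add_prob_nonneg)
    also have "\<dots> = (\<integral>\<^sup>+i. ennreal (up (sizes \<tau>) i) * (\<integral>\<^sup>+w. ennreal (add_prob w (branch \<tau> i)) \<partial>count_space UNIV) \<partial>count_space UNIV)"
      by (simp add: nn_integral_cmult)
    also have "\<dots> = (\<integral>\<^sup>+i. ennreal (up (sizes \<tau>) i) \<partial>count_space UNIV)"
      using less.hyps card_branch_less[OF less.prems(1) False] word_tree_branch[OF less.prems(1)] wt_pos_branch(1)[OF less.prems]
      by (intro nn_integral_cong) simp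
    also have "\<dots> = 1"
      unfolding nn_integral_count_space_nat using suminf_ennreal_eq[OF up_nonneg up] by simp
    finally show ?thesis .
  qed
qed

lemma del_prob_sum:
  assumes "word_tree \<tau>" "\<tau> \<noteq> {}"
  shows "(\<Sum>v\<in>\<tau>. del_prob v \<tau>) = 1"
  using assms
proof (induction "card \<tau>" arbitrary: \<tau> rule: less_induct)
  case less
  show ?case
  proof (cases "\<tau> = {[]}")
    case False
    have fin: "finite \<tau>" using less.prems by (simp add: word_tree_def)
    obtain K where K: "\<forall>j\<ge>K. branch \<tau> j = {}" using branch_bound[OF fin] by blast
    have "(\<Sum>v\<in>\<tau>. del_prob v \<tau>) = (\<Sum>v\<in>\<tau> - {[]}. del_prob v \<tau>)"
      using fin False word_tree_Nil[OF less.prems] by (simp add: sum.remove)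
    also have "\<dots> = (\<Sum>i<K. down (sizes \<tau>) i * (\<Sum>w\<in>branch \<tau> i. del_prob w (branch \<tau> i)))"
      unfolding sum_tree[OF fin K] by (simp add: sum_distrib_left)
    also have "\<dots> = (\<Sum>i<K. down (sizes \<tau>) i)"
    proof (rule sum.cong)
      fix i
      show "down (sizes \<tau>) i * (\<Sum>w\<in>branch \<tau> i. del_prob w (branch \<tau> i)) = down (sizes \<tau>) i"
      proof (cases "branch \<tau> i = {}")
        case True
        then show ?thesis by (simp add: down_eq_0 sizes_def)
      next
        case False
        then show ?thesis using less.hyps[of "branch \<tau> i"] card_branch_less[OF less.prems] word_tree_branch[OF less.prems(1)] by simp
      qed
    qed simp
    also have "\<dots> = 1"
    proof -
      obtain u where "u \<in> \<tau> - {[]}" using False word_tree_Nil[OF less.prems] by blast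
      then obtain i w where "w \<in> branch \<tau> i" by (cases u) (auto simp: branch_def)
      then have "sizes \<tau> i \<noteq> 0" using finite_branch[OF fin] by (auto simp: sizes_def)
      then show ?thesis by (rule down_sum_1[OF sizes_bound[OF K]])
    qed
    finally show ?thesis .
  qed simp
qed

lemma add_prob_support:
  assumes "word_tree \<tau>" "add_prob v \<tau> \<noteq> 0"
  shows "v \<notin> \<tau>" "word_tree (insert v \<tau>)"
proof -
  have "v \<notin> \<tau> \<and> (v = [] \<or> butlast v \<in> \<tau>)"
    using assms
  proof (induction v arbitrary: \<tau>)
    case Nil
    then show ?case by (auto split: if_splits)
  next
    case (Cons i w)
    then have ne: "\<tau> \<noteq> {}" and "add_prob w (branch \<tau> i) \<noteq> 0" by (auto split: if_splits)
    then have "w \<notin> branch \<tau> i \<and> (w = [] \<or> butlast w \<in> branch \<tau> i)"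
      using Cons word_tree_branch by blast
    then show ?case using word_tree_Nil[OF Cons.prems(1) ne] by (auto simp: branch_def)
  qed
  then show "v \<notin> \<tau>" "word_tree (insert v \<tau>)" using assms(1) unfolding word_tree_def by auto
qed

lemma del_prob_support:
  assumes "word_tree \<tau>" "del_prob v \<tau> \<noteq> 0"
  shows "v \<in> \<tau>" "word_tree (\<tau> - {v})"
proof -
  have "v \<in> \<tau> \<and> (\<forall>j. v @ [j] \<notin> \<tau>)"
    using assms
  proof (induction v arbitrary: \<tau>)
    case Nil
    then show ?case by (auto split: if_splits)
  next
    case (Cons i w)
    then have "w \<in> branch \<tau> i \<and> (\<forall>j. w @ [j] \<notin> branch \<tau> i)" using word_tree_branch by auto
    then show ?case by (auto simp: branch_def)
  qed
  then show "v \<in> \<tau>" "word_tree (\<tau> - {v})" using assms(1) unfolding word_tree_def by auto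
qed

end

section \<open>Markov chains with discrete transition probabilities\<close>

text \<open>
  A homogeneous Markov chain given by the marginal laws and the transition probabilities.
  The state space may be uncountable, as is the type of sets of words, though each law has
  countable support.
\<close>
locale pmf_chain =
  fixes \<mu> :: "nat \<Rightarrow> 's pmf" and K :: "'s \<Rightarrow> 's pmf"
  assumes step: "\<And>n. \<mu> (Suc n) = bind_pmf (\<mu> n) K"
begin

text \<open>
  On the discrete \<open>\<sigma>\<close>-algebra every family of transition laws is
  measurable, so that the theorem of Ionescu-Tulcea applies directly.
\<close>
definition coord :: "nat \<Rightarrow> 's measure" where
  "coord = (\<lambda>_. count_space UNIV)"

definition kernel :: "nat \<Rightarrow> (nat \<Rightarrow> 's) \<Rightarrow> 's measure" where
  "kernel = (\<lambda>n \<omega>. measure_pmf (case n of 0 \<Rightarrow> \<mu> 0 | Suc m \<Rightarrow> K (\<omega> m)))"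

lemma kernel_measurable: "kernel n \<in> measurable (PiM {0..<n} coord) (subprob_algebra (coord n))"
proof (cases n)
  case 0
  have "measure_pmf (\<mu> 0) \<in> space (subprob_algebra (count_space UNIV))"
    by (simp add: space_subprob_algebra prob_space_imp_subprob_space prob_space_measure_pmf)
  then show ?thesis by (simp add: 0 kernel_def coord_def)
next
  case (Suc m)
  have "(\<lambda>\<omega>. \<omega> m) \<in> measurable (PiM {0..<n} coord) (coord m)" by (rule measurable_component_singleton) (simp add: Suc)
  moreover have "(\<lambda>x. measure_pmf (K x)) \<in> measurable (coord m) (subprob_algebra (count_space UNIV))"
    by (simp add: coord_def measure_pmf_in_subprob_algebra)
  ultimately have "(\<lambda>\<omega>. measure_pmf (K (\<omega> m))) \<in> measurable (PiM {0..<n} coord) (subprob_algebra (count_space UNIV))"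
    by (rule measurable_compose)
  then show ?thesis by (simp add: Suc kernel_def coord_def)
qed

sublocale IT: Ionescu_Tulcea kernel coord
  by (rule Ionescu_Tulcea.intro) (rule kernel_measurable, simp add: kernel_def prob_space_measure_pmf)

definition "paths = IT.PF.lim"

lemma sets_paths: "sets paths = sets (PiM UNIV coord)" by (simp add: paths_def)

lemma space_paths: "space paths = UNIV" using sets_eq_imp_space_eq[OF sets_paths] by (auto simp: space_PiM coord_def)

lemma coordinate_measurable: "(\<lambda>\<omega>. \<omega> n) \<in> paths \<rightarrow>\<^sub>M count_space UNIV"
  unfolding measurable_cong_sets[OF sets_paths refl]
  using measurable_component_singleton[of n UNIV coord] by (simp add: coord_def)

declare coordinate_measurable [measurable]

lemma measurable_restrict_path: "(\<lambda>\<omega>. restrict \<omega> {0..<n}) \<in> paths \<rightarrow>\<^sub>M PiM {0..<n} coord"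
  unfolding measurable_cong_sets[OF sets_paths refl] by (rule measurable_restrict_subset) simp

lemma restrict_in_space [simp]: "restrict \<omega> {0..<n} \<in> space (PiM {0..<n} coord)"
  by (auto simp: space_PiM coord_def)

lemma cylinder_measure:
  assumes "X \<in> sets (PiM {0..<n} coord)"
  shows "emeasure paths {\<omega>. restrict \<omega> {0..<n} \<in> X} = emeasure (IT.C 0 n (\<lambda>_. undefined)) X"
proof -
  have "{\<omega>. restrict \<omega> {0..<n} \<in> X} = IT.PF.emb UNIV {0..<n} X"
    by (auto simp: prod_emb_def coord_def space_PiM)
  moreover have "IT.PF.emb {0..<n} {0..<n} X = X" using sets.sets_into_space[OF assms] by (intro prod_emb_id) (simp add: space_PiM)
  ultimately show ?thesis
    unfolding paths_def using IT.lim[of "{0..<n}" X] IT.emeasure_CI[of "{0..<n}" n X] assms by simp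
qed

sublocale paths: prob_space paths
proof
  interpret C0: prob_space "IT.C 0 0 (\<lambda>_. undefined)"
    by (rule IT.prob_space_C) (simp add: space_PiM)
  have "emeasure paths {\<omega>. restrict \<omega> {0..<0} \<in> space (PiM {0..<0} coord)} = 1"
    unfolding cylinder_measure[OF sets.top] using C0.emeasure_space_1 IT.space_C[of "\<lambda>_. undefined" 0 0] by (simp add: space_PiM)
  then show "emeasure paths (space paths) = 1" by (simp add: space_paths space_PiM restrict_def)
qed

lemma distr_restrict: "distr paths (PiM {0..<n} coord) (\<lambda>\<omega>. restrict \<omega> {0..<n}) = IT.C 0 n (\<lambda>_. undefined)"
proof (rule measure_eqI)
  fix X assume "X \<in> sets (distr paths (PiM {0..<n} coord) (\<lambda>\<omega>. restrict \<omega> {0..<n}))"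
  then have X: "X \<in> sets (PiM {0..<n} coord)" by simp
  show "emeasure (distr paths (PiM {0..<n} coord) (\<lambda>\<omega>. restrict \<omega> {0..<n})) X = emeasure (IT.C 0 n (\<lambda>_. undefined)) X"
    using cylinder_measure[OF X] by (simp add: emeasure_distr[OF measurable_restrict_path X] space_paths vimage_def)
qed (simp add: IT.sets_C[of _ 0] space_PiM)

text \<open>
  Conditioning on the first \<open>n\<close> coordinates, for events that restrict them and
  the next one.
\<close>
lemma one_step:
  assumes A: "A \<in> sets (PiM {0..<n} coord)"
  shows "emeasure paths {\<omega>. restrict \<omega> {0..<n} \<in> A \<and> \<omega> n \<in> B} =
    (\<integral>\<^sup>+\<omega>. indicator A (restrict \<omega> {0..<n}) * emeasure (kernel n (restrict \<omega> {0..<n})) B \<partial>paths)"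
proof -
  define X where "X = {\<omega> \<in> space (PiM {0..<Suc n} coord). restrict \<omega> {0..<n} \<in> A \<and> \<omega> n \<in> B}"
  have r: "(\<lambda>\<omega>. restrict \<omega> {0..<n}) \<in> PiM {0..<Suc n} coord \<rightarrow>\<^sub>M PiM {0..<n} coord"
    by (rule measurable_restrict_subset) auto
  have c: "(\<lambda>\<omega>. \<omega> n) \<in> PiM {0..<Suc n} coord \<rightarrow>\<^sub>M coord n" by (rule measurable_component_singleton) simp
  have X: "X \<in> sets (PiM {0..<Suc n} coord)"
  proof -
    have "X = ((\<lambda>\<omega>. restrict \<omega> {0..<n}) -` A \<inter> space (PiM {0..<Suc n} coord)) \<inter> ((\<lambda>\<omega>. \<omega> n) -` B \<inter> space (PiM {0..<Suc n} coord))"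
      by (auto simp: X_def)
    then show ?thesis using measurable_sets[OF r A] measurable_sets[OF c, of B] by (simp add: coord_def)
  qed
  have "{\<omega>. restrict \<omega> {0..<n} \<in> A \<and> \<omega> n \<in> B} = {\<omega>. restrict \<omega> {0..<Suc n} \<in> X}"
  proof -
    have "restrict \<omega> {0..<Suc n} \<in> space (PiM {0..<Suc n} coord)" for \<omega> by (auto simp: space_PiM coord_def)
    moreover have "restrict (restrict \<omega> {0..<Suc n}) {0..<n} = restrict \<omega> {0..<n}" for \<omega> :: "nat \<Rightarrow> 's" by (auto simp: fun_eq_iff)
    ultimately show ?thesis by (auto simp: X_def)
  qed
  then have "emeasure paths {\<omega>. restrict \<omega> {0..<n} \<in> A \<and> \<omega> n \<in> B} = emeasure (IT.C 0 (Suc n) (\<lambda>_. undefined)) X"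
    using cylinder_measure[OF X] by simp
  also have "\<dots> = (\<integral>\<^sup>+\<omega>. emeasure (IT.eP n \<omega>) X \<partial>IT.C 0 n (\<lambda>_. undefined))"
  proof -
    have ms: "IT.eP n \<in> IT.C 0 n (\<lambda>_. undefined) \<rightarrow>\<^sub>M subprob_algebra (PiM {0..<Suc n} coord)"
      using IT.measurable_eP[of n] by (subst measurable_cong_sets[OF IT.sets_C refl]) (simp_all add: space_PiM)
    have ne: "space (IT.C 0 n (\<lambda>_. undefined)) \<noteq> {}"
      by (rule prob_space.not_empty, rule IT.prob_space_C) (simp add: space_PiM)
    show ?thesis using emeasure_bind[OF ne ms X] by simp
  qed
  also have "\<dots> = (\<integral>\<^sup>+\<omega>. indicator A \<omega> * emeasure (kernel n \<omega>) B \<partial>IT.C 0 n (\<lambda>_. undefined))"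
  proof (rule nn_integral_cong)
    fix \<omega> assume "\<omega> \<in> space (IT.C 0 n (\<lambda>_. undefined))"
    then have w: "\<omega> \<in> space (PiM {0..<n} coord)" using IT.space_C[of "\<lambda>_. undefined" 0 n] by (simp add: space_PiM)
    have res: "restrict (fun_upd \<omega> n y) {0..<n} = \<omega>" for y
      using w by (auto simp: space_PiM PiE_def extensional_def fun_eq_iff)
    have sp: "fun_upd \<omega> n y \<in> space (PiM {0..<Suc n} coord)" for y
      using w by (auto simp: space_PiM PiE_def extensional_def coord_def)
    have "(\<lambda>y. fun_upd \<omega> n y) -` X \<inter> space (coord n) = (if \<omega> \<in> A then B else {})"
      using res sp by (auto simp: X_def coord_def)
    then show "emeasure (IT.eP n \<omega>) X = indicator A \<omega> * emeasure (kernel n \<omega>) B"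
      using IT.emeasure_eP[OF w X] by simp
  qed
  also have "\<dots> = (\<integral>\<^sup>+\<omega>. indicator A (restrict \<omega> {0..<n}) * emeasure (kernel n (restrict \<omega> {0..<n})) B \<partial>paths)"
  proof -
    have "(\<lambda>\<omega>. emeasure (kernel n \<omega>) B) \<in> borel_measurable (PiM {0..<n} coord)"
      by (rule measurable_emeasure_kernel[OF kernel_measurable]) (simp add: coord_def)
    then have "(\<lambda>\<omega>. indicator A \<omega> * emeasure (kernel n \<omega>) B) \<in> borel_measurable (PiM {0..<n} coord)"
      using A by measurable
    then show ?thesis unfolding distr_restrict[symmetric] by (intro nn_integral_distr measurable_restrict_path) simp
  qed
  finally show ?thesis .
qed

lemma marginal_law_all_paths: "distr paths (count_space UNIV) (\<lambda>\<omega>. \<omega> n) = measure_pmf (\<mu> n)"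
proof (induction n)
  case 0
  show ?case
  proof (rule measure_eqI)
    fix B :: "'s set"
    have "emeasure paths {\<omega>. restrict \<omega> {0..<0} \<in> space (PiM {0..<0} coord) \<and> \<omega> 0 \<in> B} = emeasure (measure_pmf (\<mu> 0)) B"
      using one_step[OF sets.top, of 0 B] paths.emeasure_space_1 by (simp add: kernel_def del: atLeastLessThan_empty_iff atLeastLessThan_empty_iff2 atLeastLessThan_empty)
    then show "emeasure (distr paths (count_space UNIV) (\<lambda>\<omega>. \<omega> 0)) B = emeasure (measure_pmf (\<mu> 0)) B"
      by (simp add: emeasure_distr[OF coordinate_measurable] space_paths vimage_def del: atLeastLessThan_empty_iff atLeastLessThan_empty_iff2 atLeastLessThan_empty)
  qed simp
next
  case (Suc n)
  show ?case
  proof (rule measure_eqI)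
    fix B :: "'s set"
    have "emeasure paths {\<omega>. restrict \<omega> {0..<Suc n} \<in> space (PiM {0..<Suc n} coord) \<and> \<omega> (Suc n) \<in> B}
        = (\<integral>\<^sup>+\<omega>. emeasure (measure_pmf (K (\<omega> n))) B \<partial>paths)"
      using one_step[OF sets.top, of "Suc n" B] by (simp add: kernel_def)
    also have "\<dots> = (\<integral>\<^sup>+x. emeasure (measure_pmf (K x)) B \<partial>distr paths (count_space UNIV) (\<lambda>\<omega>. \<omega> n))"
      by (subst nn_integral_distr[OF coordinate_measurable]) simp_all
    also have "\<dots> = emeasure (measure_pmf (\<mu> (Suc n))) B"
      unfolding Suc step by (simp add: emeasure_bind_pmf)
    finally show "emeasure (distr paths (count_space UNIV) (\<lambda>\<omega>. \<omega> (Suc n))) B = emeasure (measure_pmf (\<mu> (Suc n))) B"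
      by (simp add: emeasure_distr[OF coordinate_measurable] space_paths vimage_def)
  qed simp
qed

lemma kernel_step:
  assumes A: "A \<in> sets (PiM {0..<Suc n} coord)" and z: "\<And>\<omega>. \<omega> \<in> A \<Longrightarrow> \<omega> n = z"
  shows "emeasure paths {\<omega>. restrict \<omega> {0..<Suc n} \<in> A \<and> \<omega> (Suc n) \<in> B} = emeasure paths {\<omega>. restrict \<omega> {0..<Suc n} \<in> A} * emeasure (measure_pmf (K z)) B"
proof -
  have m: "{\<omega>. restrict \<omega> {0..<Suc n} \<in> A} \<in> sets paths"
    using measurable_sets[OF measurable_restrict_path A] by (simp add: vimage_def space_paths)
  have "emeasure paths {\<omega>. restrict \<omega> {0..<Suc n} \<in> A \<and> \<omega> (Suc n) \<in> B}
      = (\<integral>\<^sup>+\<omega>. emeasure (measure_pmf (K z)) B * indicator {\<omega>. restrict \<omega> {0..<Suc n} \<in> A} \<omega> \<partial>paths)"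
    unfolding one_step[OF A]
  proof (rule nn_integral_cong)
    fix \<omega>
    show "indicator A (restrict \<omega> {0..<Suc n}) * emeasure (kernel (Suc n) (restrict \<omega> {0..<Suc n})) B
      = emeasure (measure_pmf (K z)) B * indicator {\<omega>. restrict \<omega> {0..<Suc n} \<in> A} \<omega>"
      using z[of "restrict \<omega> {0..<Suc n}"] by (auto simp: kernel_def indicator_def)
  qed
  then show ?thesis using m by (simp add: nn_integral_cmult_indicator mult.commute)
qed

lemma cylinder_sets:
  assumes "I \<subseteq> {0..<Suc n}"
  shows "{\<omega> \<in> space (PiM {0..<Suc n} coord). \<forall>k\<in>I. \<omega> k = x k} \<in> sets (PiM {0..<Suc n} coord)"
proof -
  have fin: "finite I" using assms finite_subset by blast
  have "{\<omega> \<in> space (PiM {0..<Suc n} coord). \<omega> k = x k} \<in> sets (PiM {0..<Suc n} coord)" if "k \<in> I" for k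
  proof -
    have "(\<lambda>\<omega>. \<omega> k) \<in> PiM {0..<Suc n} coord \<rightarrow>\<^sub>M coord k"
      using that assms by (intro measurable_component_singleton) auto
    from measurable_sets[OF this, of "{x k}"] show ?thesis by (simp add: coord_def vimage_def Int_def conj_commute)
  qed
  then show ?thesis by (intro sets.sets_Collect_finite_All fin)
qed

lemma path_step:
  assumes I: "I \<subseteq> {0..<Suc n}" "n \<in> I"
  shows "emeasure paths {\<omega>. (\<forall>k\<in>I. \<omega> k = x k) \<and> \<omega> (Suc n) \<in> B} = emeasure paths {\<omega>. \<forall>k\<in>I. \<omega> k = x k} * emeasure (measure_pmf (K (x n))) B"
proof -
  let ?A = "{\<omega> \<in> space (PiM {0..<Suc n} coord). \<forall>k\<in>I. \<omega> k = x k}"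
  have "restrict \<omega> {0..<Suc n} \<in> ?A \<longleftrightarrow> (\<forall>k\<in>I. \<omega> k = x k)" for \<omega>
    using I(1) by (auto simp: space_PiM coord_def subset_eq)
  then show ?thesis using kernel_step[of ?A n "x n" B] cylinder_sets[OF I(1), of x] I(2) by simp
qed

text \<open>
  The paths that always move along possible transitions. On them monotonicity holds
  everywhere and not only almost surely. Ranging over the support of the law makes the set
  measurable by countable operations.
\<close>
definition "good = {\<omega> \<in> space paths. \<forall>n. \<exists>x\<in>set_pmf (\<mu> n). \<omega> n = x \<and> \<omega> (Suc n) \<in> set_pmf (K x)}"

lemma good_sets [measurable]: "good \<in> sets paths"
  unfolding good_def by (intro sets.sets_Collect_countable_All sets.sets_Collect_countable_Bex) measurable

lemma AE_good: "AE \<omega> in paths. \<omega> \<in> good"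
proof -
  have "AE \<omega> in paths. \<forall>n. \<exists>x\<in>set_pmf (\<mu> n). \<omega> n = x \<and> \<omega> (Suc n) \<in> set_pmf (K x)"
    unfolding AE_all_countable
  proof
    fix n
    have "AE x in distr paths (count_space UNIV) (\<lambda>\<omega>. \<omega> n). x \<in> set_pmf (\<mu> n)"
      unfolding marginal_law_all_paths by (simp add: AE_measure_pmf_iff)
    then have 1: "AE \<omega> in paths. \<omega> n \<in> set_pmf (\<mu> n)" by (subst (asm) AE_distr_iff) auto
    have 2: "AE \<omega> in paths. \<forall>x\<in>set_pmf (\<mu> n). \<omega> n = x \<longrightarrow> \<omega> (Suc n) \<in> set_pmf (K x)"
    proof (subst AE_ball_countable, simp, intro ballI)
      fix x
      have m: "{\<omega> \<in> space paths. \<omega> n = x \<and> \<omega> (Suc n) \<in> - set_pmf (K x)} \<in> sets paths" by measurable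
      have "emeasure paths {\<omega> \<in> space paths. \<omega> n = x \<and> \<omega> (Suc n) \<in> - set_pmf (K x)} = 0"
        using path_step[of "{n}" n "\<lambda>_. x" "- set_pmf (K x)"]
        by (simp add: space_paths measure_pmf.emeasure_eq_measure measure_pmf_zero_iff)
      from AE_I[OF _ this m] show "AE \<omega> in paths. \<omega> n = x \<longrightarrow> \<omega> (Suc n) \<in> set_pmf (K x)" by auto
    qed
    show "AE \<omega> in paths. \<exists>x\<in>set_pmf (\<mu> n). \<omega> n = x \<and> \<omega> (Suc n) \<in> set_pmf (K x)"
      using 1 2 by eventually_elim auto
  qed
  then show ?thesis by (simp add: good_def space_paths)
qed

lemma good_measure_1: "emeasure paths good = 1" using paths.emeasure_eq_1_AE[OF good_sets] AE_good by simp

definition "chain_measure = restrict_space paths good"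

lemma space_chain: "space chain_measure = good" by (simp add: chain_measure_def space_restrict_space space_paths)

lemma prob_space_chain: "prob_space chain_measure" unfolding chain_measure_def by (rule prob_space_restrict_space[OF good_sets good_measure_1])

lemma emeasure_good: "emeasure chain_measure {\<omega> \<in> good. Q \<omega>} = emeasure paths {\<omega>. Q \<omega>}" if "{\<omega>. Q \<omega>} \<in> sets paths"
proof -
  have "emeasure chain_measure {\<omega> \<in> good. Q \<omega>} = emeasure paths {\<omega> \<in> good. Q \<omega>}"
    unfolding chain_measure_def by (subst emeasure_restrict_space) (auto simp: good_sets)
  also have "\<dots> = emeasure paths {\<omega>. Q \<omega>}"
    using AE_good that good_sets by (intro emeasure_eq_AE) (auto intro: sets.Int simp: Collect_conj_eq)
  finally show ?thesis .
qed

lemma chain_coordinate_measurable: "(\<lambda>\<omega>. \<omega> n) \<in> chain_measure \<rightarrow>\<^sub>M count_space UNIV"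
  unfolding chain_measure_def by (rule measurable_restrict_space1) (rule coordinate_measurable)

lemma event_sets: "{\<omega>. (\<forall>k\<in>I. \<omega> k = x k) \<and> \<omega> (Suc n) = y} \<in> sets paths" "{\<omega>. \<forall>k\<in>I. \<omega> k = x k} \<in> sets paths" if "finite I"
proof -
  have "{\<omega> \<in> space paths. \<forall>k\<in>I. \<omega> k = x k} \<in> sets paths"
    by (intro sets.sets_Collect_finite_All that) measurable
  moreover have "{\<omega> \<in> space paths. \<omega> (Suc n) = y} \<in> sets paths" by measurable
  ultimately show "{\<omega>. (\<forall>k\<in>I. \<omega> k = x k) \<and> \<omega> (Suc n) = y} \<in> sets paths" "{\<omega>. \<forall>k\<in>I. \<omega> k = x k} \<in> sets paths"
    using sets.Int by (auto simp: space_paths Collect_conj_eq)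
qed

text \<open>
  Conditioned on any set of coordinates containing the last one, the next state depends on
  the last one only.
\<close>
lemma markov_step:
  assumes I: "I \<subseteq> {0..<Suc n}" "n \<in> I"
  shows "\<P>(\<omega> in chain_measure. (\<forall>k\<in>I. \<omega> k = x k) \<and> \<omega> (Suc n) = y) = \<P>(\<omega> in chain_measure. \<forall>k\<in>I. \<omega> k = x k) * pmf (K (x n)) y"
proof -
  have fin: "finite I" using I(1) finite_subset by blast
  show ?thesis using path_step[OF I, of x "{y}"] emeasure_good[OF event_sets(1)[OF fin, of x n y]] emeasure_good[OF event_sets(2)[OF fin, of x]]
    unfolding measure_def space_chain by (simp add: enn2real_mult emeasure_pmf_single)
qed

lemma marginal_law: "distr chain_measure (count_space UNIV) (\<lambda>\<omega>. \<omega> n) = measure_pmf (\<mu> n)"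
proof (rule measure_eqI)
  fix B :: "'s set"
  have "emeasure (distr chain_measure (count_space UNIV) (\<lambda>\<omega>. \<omega> n)) B = emeasure chain_measure {\<omega> \<in> good. \<omega> n \<in> B}"
    by (simp add: emeasure_distr[OF chain_coordinate_measurable] space_chain vimage_def Int_def conj_commute)
  also have "\<dots> = emeasure paths {\<omega>. \<omega> n \<in> B}"
    using measurable_sets[OF coordinate_measurable, of B n] by (intro emeasure_good) (simp add: vimage_def space_paths)
  also have "\<dots> = emeasure (measure_pmf (\<mu> n)) B"
    unfolding marginal_law_all_paths[symmetric] by (simp add: emeasure_distr[OF coordinate_measurable] space_paths vimage_def)
  finally show "emeasure (distr chain_measure (count_space UNIV) (\<lambda>\<omega>. \<omega> n)) B = emeasure (measure_pmf (\<mu> n)) B" .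
qed simp

end

context edge_weights
begin

section \<open>The growing tree\<close>

definition grow :: "nat list set \<Rightarrow> nat list set pmf" where
  "grow \<tau> = map_pmf (\<lambda>v. insert v \<tau>) (embed_pmf (\<lambda>v. add_prob v \<tau>))"

text \<open>
  Different words lead to different trees.
\<close>
lemma pmf_grow:
  assumes "word_tree \<tau>" "0 < wt \<tau>" "v \<notin> \<tau>"
  shows "pmf (grow \<tau>) (insert v \<tau>) = add_prob v \<tau>"
proof -
  have "(\<lambda>v. insert v \<tau>) -` {insert v \<tau>} = {v}"
    using assms(3) by auto (metis insertE insertI1)
  then show ?thesis
    unfolding grow_def pmf_map
    by (simp add: measure_pmf_single pmf_embed_pmf add_prob_nonneg add_prob_total assms)
qed

lemma set_grow:
  assumes "word_tree \<tau>" "0 < wt \<tau>" "\<tau>' \<in> set_pmf (grow \<tau>)"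
  obtains v where "v \<notin> \<tau>" "\<tau>' = insert v \<tau>" "word_tree \<tau>'"
proof -
  from assms(3) obtain v where "add_prob v \<tau> \<noteq> 0" "\<tau>' = insert v \<tau>"
    unfolding grow_def by (auto simp: set_embed_pmf add_prob_nonneg add_prob_total assms)
  with add_prob_support[OF assms(1)] that show ?thesis by blast
qed

text \<open>
  The law at time \<open>n\<close> lives on trees with \<open>n + 1\<close> vertices.
\<close>
primrec tree_law :: "nat \<Rightarrow> nat list set pmf" where
  "tree_law 0 = return_pmf {[]}"
| "tree_law (Suc n) = bind_pmf (tree_law n) grow"

text \<open>
  Sum detailed balance over the vertices of the new tree: the deletion probabilities add up
  to 1.
\<close>
lemma pmf_tree_law:
  "pmf (tree_law n) \<tau> = (if word_tree \<tau> \<and> card \<tau> = Suc n then wt \<tau> / sibs 0 n else 0)"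
proof (induction n arbitrary: \<tau>)
  case 0
  have "\<tau> = {[]} \<longleftrightarrow> word_tree \<tau> \<and> card \<tau> = Suc 0"
  proof
    assume \<tau>: "word_tree \<tau> \<and> card \<tau> = Suc 0"
    then have "[] \<in> \<tau>" using word_tree_Nil[of \<tau>] by force
    then show "\<tau> = {[]}" using \<tau> by (metis card_1_singletonE singletonD One_nat_def)
  qed (simp add: word_tree_singleton)
  then show ?case by (auto simp: wt_def indicator_def)
next
  case (Suc n)
  have supp: "word_tree \<sigma>" "card \<sigma> = Suc n" "0 < wt \<sigma>" if "\<sigma> \<in> set_pmf (tree_law n)" for \<sigma>
    using that Suc[of \<sigma>] wt_nonneg[of \<sigma>] by (auto simp: set_pmf_iff less_le split: if_splits)
  show ?case
  proof (cases "word_tree \<tau> \<and> card \<tau> = Suc (Suc n)")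
    case False
    have "\<tau> \<notin> set_pmf (tree_law (Suc n))"
    proof
      assume "\<tau> \<in> set_pmf (tree_law (Suc n))"
      then obtain \<sigma> where \<sigma>: "\<sigma> \<in> set_pmf (tree_law n)" "\<tau> \<in> set_pmf (grow \<sigma>)" by auto
      note s = supp[OF \<sigma>(1)]
      obtain v where "v \<notin> \<sigma>" "\<tau> = insert v \<sigma>" "word_tree \<tau>" using set_grow[OF s(1,3) \<sigma>(2)] by blast
      moreover have "finite \<sigma>" using s by (simp add: word_tree_def)
      ultimately show False using False s(2) by simp
    qed
    then show ?thesis unfolding if_not_P[OF False] by (simp only: set_pmf_iff not_not)
  next
    case True
    then have fin: "finite \<tau>" and \<tau>: "word_tree \<tau>" and ne: "\<tau> \<noteq> {}" by (auto simp: word_tree_def)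
    \<comment> \<open>The possible predecessors of \<open>\<tau>\<close> arise by deleting one vertex.\<close>
    let ?A = "(\<lambda>v. \<tau> - {v}) ` \<tau>"
    have "pmf (tree_law (Suc n)) \<tau> = (\<Sum>\<sigma>\<in>?A. pmf (grow \<sigma>) \<tau> * pmf (tree_law n) \<sigma>)"
      unfolding tree_law.simps pmf_bind
    proof (rule integral_measure_pmf_real)
      fix \<sigma> assume \<sigma>: "\<sigma> \<in> set_pmf (tree_law n)" "pmf (grow \<sigma>) \<tau> \<noteq> 0"
      note s = supp[OF \<sigma>(1)]
      obtain v where "v \<notin> \<sigma>" "\<tau> = insert v \<sigma>"
        using set_grow[OF s(1,3), of \<tau>] \<sigma>(2) by (auto simp: set_pmf_iff)
      then show "\<sigma> \<in> ?A" by auto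
    qed (use fin in simp)
    also have "\<dots> = (\<Sum>v\<in>\<tau>. pmf (grow (\<tau> - {v})) \<tau> * pmf (tree_law n) (\<tau> - {v}))"
      by (subst sum.reindex) (auto simp: inj_on_def)
    also have "\<dots> = (\<Sum>v\<in>\<tau>. norm_wt \<tau> * del_prob v \<tau>)"
    proof (rule sum.cong)
      fix v assume v: "v \<in> \<tau>"
      then have ins: "insert v (\<tau> - {v}) = \<tau>" by auto
      have c: "card (\<tau> - {v}) = Suc n" using True v fin by simp
      then have ne': "\<tau> - {v} \<noteq> {}" by (metis card.empty nat.distinct(1))
      show "pmf (grow (\<tau> - {v})) \<tau> * pmf (tree_law n) (\<tau> - {v}) = norm_wt \<tau> * del_prob v \<tau>"
      proof (cases "word_tree (\<tau> - {v})")
        case False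
        then have "del_prob v \<tau> = 0" using del_prob_support(2)[OF \<tau>] by blast
        then show ?thesis using False Suc by simp
      next
        case True
        have r: "norm_wt (\<tau> - {v}) = pmf (tree_law n) (\<tau> - {v})"
          using True c ne' unfolding Suc norm_wt_def by simp
        have db: "norm_wt (\<tau> - {v}) * add_prob v (\<tau> - {v}) = norm_wt \<tau> * del_prob v \<tau>"
          using detailed_balance[OF True, of v] ins \<tau> by simp
        show ?thesis
        proof (cases "0 < wt (\<tau> - {v})")
          case pos: True
          then show ?thesis using pmf_grow[OF True pos, of v] db r ins by (simp add: mult.commute)
        next
          case False
          then have "norm_wt (\<tau> - {v}) = 0" using wt_nonneg[of "\<tau> - {v}"] c ne' by (simp add: norm_wt_def)
          then show ?thesis using db r by simp
        qed
      qed
    qed simp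
    also have "\<dots> = norm_wt \<tau>" using del_prob_sum[OF \<tau> ne] by (simp add: sum_distrib_left[symmetric])
    also have "\<dots> = wt \<tau> / sibs 0 (Suc n)" using True ne by (simp add: norm_wt_def)
    finally show ?thesis using True by simp
  qed
qed

lemma set_tree_law: "set_pmf (tree_law n) = {\<tau>. word_tree \<tau> \<and> card \<tau> = Suc n \<and> 0 < wt \<tau>}"
proof -
  have "wt \<tau> / sibs 0 n \<noteq> 0 \<longleftrightarrow> 0 < wt \<tau>" for \<tau>
    using sibs_0_pos[of n] wt_nonneg[of \<tau>] by auto
  then show ?thesis unfolding set_eq_iff set_pmf_iff pmf_tree_law mem_Collect_eq by (simp, blast)
qed

text \<open>
  Positive weight excludes the letter 0.
\<close>
lemma wt_pos_imp_rooted: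
  assumes "word_tree \<tau>" "0 < wt \<tau>" "\<tau> \<noteq> {}"
  shows "rooted_subtree \<tau>"
proof -
  have fin: "finite \<tau>" using assms by (simp add: word_tree_def)
  have "u \<in> \<tau> \<Longrightarrow> u \<in> ulam_harris" for u
  proof (induction u rule: rev_induct)
    case (snoc i u)
    then have "u \<in> \<tau>" using assms(1) by (auto simp: word_tree_def)
    moreover have "0 < \<theta> i" using snoc.prems assms(2) unfolding wt_pos_iff[OF fin] by force
    then have "1 \<le> i" using zero_at_0 by (cases i) auto
    ultimately show ?case using snoc.IH by (auto simp: ulam_harris_def)
  qed (simp add: ulam_harris_def)
  then show ?thesis using assms fin by (auto simp: rooted_subtree_def word_tree_def)
qed

lemma rooted_imp_word_tree: "rooted_subtree \<tau> \<Longrightarrow> word_tree \<tau>"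
  unfolding word_tree_def
proof (intro conjI allI impI)
  fix u i assume \<tau>: "rooted_subtree \<tau>" and "u @ [i] \<in> \<tau>"
  then have "u @ [i] \<in> ulam_harris" by (auto simp: rooted_subtree_def)
  then have "u \<in> ulam_harris" "1 \<le> i" by (auto simp: ulam_harris_def)
  then show "u \<in> \<tau>" using \<tau> \<open>u @ [i] \<in> \<tau>\<close> unfolding rooted_subtree_def by blast
qed (simp add: rooted_subtree_def)

lemma weight_eq_wt:
  assumes "rooted_subtree \<tau>"
  shows "weight \<theta> \<tau> = wt \<tau>"
proof -
  have fin: "finite (\<tau> - {[]})" and sub: "\<tau> \<subseteq> ulam_harris" using assms by (auto simp: rooted_subtree_def)
  have num: "num_type i \<tau> = card {u \<in> \<tau> - {[]}. last u = i}" for i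
  proof -
    have "{u \<in> \<tau>. \<exists>v\<in>ulam_harris. u = v @ [i]} = {u \<in> \<tau> - {[]}. last u = i}"
    proof (intro set_eqI iffI)
      fix u assume u: "u \<in> {u \<in> \<tau> - {[]}. last u = i}"
      then have eq: "u = butlast u @ [i]" by (metis (mono_tags, lifting) DiffE append_butlast_last_id mem_Collect_eq singletonI)
      moreover have "butlast u \<in> ulam_harris" using u sub by (auto simp: ulam_harris_def dest: in_set_butlastD)
      ultimately show "u \<in> {u \<in> \<tau>. \<exists>v\<in>ulam_harris. u = v @ [i]}" using u by blast
    qed auto
    then show ?thesis by (simp add: num_type_def)
  qed
  have types: "{i. 1 \<le> i \<and> num_type i \<tau> \<noteq> 0} = last ` (\<tau> - {[]})"
  proof (intro set_eqI iffI)
    fix i assume "i \<in> last ` (\<tau> - {[]})"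
    then obtain u where u: "u \<in> \<tau> - {[]}" "last u = i" by auto
    then have "1 \<le> i" using sub last_in_set[of u] by (auto simp: ulam_harris_def)
    moreover have "num_type i \<tau> \<noteq> 0" unfolding num using u fin by auto
    ultimately show "i \<in> {i. 1 \<le> i \<and> num_type i \<tau> \<noteq> 0}" by simp
  next
    fix i assume "i \<in> {i. 1 \<le> i \<and> num_type i \<tau> \<noteq> 0}"
    then have "num_type i \<tau> \<noteq> 0" by blast
    then have "card {u \<in> \<tau> - {[]}. last u = i} \<noteq> 0" unfolding num .
    then have "{u \<in> \<tau> - {[]}. last u = i} \<noteq> {}" by (metis card.empty)
    then show "i \<in> last ` (\<tau> - {[]})" by auto
  qed
  have "wt \<tau> = (\<Prod>i\<in>last ` (\<tau> - {[]}). \<Prod>u\<in>{u \<in> \<tau> - {[]}. last u = i}. \<theta> (last u))"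
    unfolding wt_def by (rule prod.image_gen[OF fin])
  also have "\<dots> = weight \<theta> \<tau>"
    unfolding weight_def types by (intro prod.cong) (auto simp: num)
  finally show ?thesis by simp
qed

text \<open>
  The normalising constant is found without enumerating trees, from the fact that
  \<open>tree_law n\<close> has total mass 1.
\<close>
lemma infsum_weight: "infsum (weight \<theta>) (rooted_subtrees (Suc n)) = sibs 0 n"
proof -
  let ?R = "rooted_subtrees (Suc n)"
  have "set_pmf (tree_law n) \<subseteq> ?R"
    unfolding set_tree_law rooted_subtrees_def by (auto intro!: wt_pos_imp_rooted)
  then have "infsetsum (pmf (tree_law n)) ?R = 1" by (rule infsetsum_pmf_eq_1)
  then have "infsum (pmf (tree_law n)) ?R = 1"
    using infsetsum_infsum[OF pmf_abs_summable, of "tree_law n" ?R] by simp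
  moreover have "infsum (weight \<theta>) ?R = infsum (\<lambda>\<tau>. sibs 0 n * pmf (tree_law n) \<tau>) ?R"
    using sibs_0_pos[of n] by (intro infsum_cong) (auto simp: rooted_subtrees_def pmf_tree_law weight_eq_wt rooted_imp_word_tree)
  ultimately show ?thesis by (simp add: infsum_cmult_right')
qed

lemma ST_mass_eq:
  assumes "\<tau> \<in> rooted_subtrees (Suc n)"
  shows "ST_mass \<theta> (Suc n) \<tau> = pmf (tree_law n) \<tau>"
  using assms unfolding ST_mass_def infsum_weight pmf_tree_law
  by (simp add: rooted_subtrees_def weight_eq_wt rooted_imp_word_tree)

lemma coupling_exists:
  "\<exists>(M :: (nat \<Rightarrow> nat list set) measure) (T :: nat \<Rightarrow> (nat \<Rightarrow> nat list set) \<Rightarrow> nat list set).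
     markov_process M rooted_subtrees T \<and>
     (\<forall>n\<ge>1. distr M (count_space (rooted_subtrees n)) (T n) = ST \<theta> n) \<and>
     (\<forall>\<omega>\<in>space M. \<forall>n\<ge>1. T n \<omega> \<subseteq> T (Suc n) \<omega> \<and> T n \<omega> \<subseteq> ulam_harris)"
proof -
  interpret chain: pmf_chain tree_law grow by unfold_locales simp
  \<comment> \<open>The tree with \<open>n\<close> vertices is the state of the chain at time \<open>n -
      1\<close>.\<close>
  let ?M = chain.chain_measure and ?T = "\<lambda>n \<omega>. \<omega> (n - 1) :: nat list set"
  interpret M: prob_space ?M by (rule chain.prob_space_chain)
  have state: "\<omega> n \<in> set_pmf (tree_law n)" "\<omega> (Suc n) \<in> set_pmf (grow (\<omega> n))" if "\<omega> \<in> space ?M" for \<omega> n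
    using that unfolding chain.space_chain chain.good_def by auto
  have rooted: "\<omega> n \<in> rooted_subtrees (Suc n)" if "\<omega> \<in> space ?M" for \<omega> n
    using state(1)[OF that, of n] unfolding set_tree_law rooted_subtrees_def by (auto intro!: wt_pos_imp_rooted)
  have countable: "countable (rooted_subtrees n)" for n
    by (rule countable_subset[OF _ countable_Collect_finite]) (auto simp: rooted_subtrees_def rooted_subtree_def)
  have set_meas: "{\<omega> \<in> space ?M. \<omega> n \<in> A} \<in> sets ?M" for n A
    using measurable_sets[OF chain.chain_coordinate_measurable[of n], of A] by (simp add: vimage_def Int_def conj_commute)
  have meas: "(\<lambda>\<omega>. \<omega> n) \<in> ?M \<rightarrow>\<^sub>M count_space (rooted_subtrees (Suc n))" for n
  proof (rule measurableI)
    show "\<omega> n \<in> space (count_space (rooted_subtrees (Suc n)))" if "\<omega> \<in> space ?M" for \<omega>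
      using rooted[OF that] by simp
    show "(\<lambda>\<omega>. \<omega> n) -` A \<inter> space ?M \<in> sets ?M" for A
      using set_meas[of n A] by (simp add: vimage_def Int_def conj_commute)
  qed
  have markov: "markov_process ?M rooted_subtrees ?T"
    unfolding markov_process_def
  proof (intro conjI allI impI)
    fix n :: nat assume "1 \<le> n"
    then show "?T n \<in> measurable ?M (count_space (rooted_subtrees n))" using meas[of "n - 1"] by simp
  next
    fix n :: nat and x :: "nat \<Rightarrow> nat list set" and y
    assume "1 \<le> n"
    then obtain m where n: "n = Suc m" by (cases n) auto
    let ?Q = "\<lambda>\<omega>. \<forall>k\<in>{0..<Suc m}. \<omega> k = x (Suc k)"
    have Q: "(\<forall>k\<in>{1..n}. ?T k \<omega> = x k) \<longleftrightarrow> ?Q \<omega>" for \<omega>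
    proof
      assume path: "?Q \<omega>"
      show "\<forall>k\<in>{1..n}. ?T k \<omega> = x k"
      proof
        fix k assume "k \<in> {1..n}"
        then show "?T k \<omega> = x k" using path[rule_format, of "k - 1"] n by auto
      qed
    next
      assume path: "\<forall>k\<in>{1..n}. ?T k \<omega> = x k"
      show "?Q \<omega>"
      proof
        fix k assume "k \<in> {0..<Suc m}"
        then show "\<omega> k = x (Suc k)" using path[rule_format, of "Suc k"] n by auto
      qed
    qed
    assume "0 < \<P>(\<omega> in ?M. \<forall>k\<in>{1..n}. ?T k \<omega> = x k)"
    then have pos: "0 < \<P>(\<omega> in ?M. ?Q \<omega>)" unfolding Q .
    also have "\<dots> \<le> \<P>(\<omega> in ?M. \<omega> m = x n)"
      using set_meas[of m "{x n}"] by (intro M.finite_measure_mono) (auto simp: n)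
    finally have pos': "0 < \<P>(\<omega> in ?M. \<omega> m = x n)" .
    have "\<P>(\<omega> in ?M. ?T (Suc n) \<omega> = y \<bar> \<forall>k\<in>{1..n}. ?T k \<omega> = x k) = pmf (grow (x n)) y"
      using chain.markov_step[of "{0..<Suc m}" m "\<lambda>k. x (Suc k)" y] pos
      unfolding cond_prob_def Q by (simp add: n conj_commute)
    moreover have "\<P>(\<omega> in ?M. ?T (Suc n) \<omega> = y \<bar> ?T n \<omega> = x n) = pmf (grow (x n)) y"
      using chain.markov_step[of "{m}" m "\<lambda>k. x (Suc k)" y] pos'
      unfolding cond_prob_def by (simp add: n conj_commute)
    ultimately show "\<P>(\<omega> in ?M. ?T (Suc n) \<omega> = y \<bar> \<forall>k\<in>{1..n}. ?T k \<omega> = x k) = \<P>(\<omega> in ?M. ?T (Suc n) \<omega> = y \<bar> ?T n \<omega> = x n)"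
      by simp
  qed (rule chain.prob_space_chain countable)+
  have law: "distr ?M (count_space (rooted_subtrees (Suc n))) (\<lambda>\<omega>. \<omega> n) = ST \<theta> (Suc n)" for n
  proof (rule measure_eqI)
    let ?R = "rooted_subtrees (Suc n)"
    fix A assume "A \<in> sets (distr ?M (count_space ?R) (\<lambda>\<omega>. \<omega> n))"
    then have A: "A \<subseteq> ?R" by simp
    have "emeasure (distr ?M (count_space ?R) (\<lambda>\<omega>. \<omega> n)) A = emeasure (distr ?M (count_space UNIV) (\<lambda>\<omega>. \<omega> n)) A"
      using A by (simp add: emeasure_distr meas chain.chain_coordinate_measurable)
    also have "\<dots> = (\<integral>\<^sup>+\<tau>. pmf (tree_law n) \<tau> \<partial>count_space A)"
      unfolding chain.marginal_law by (rule nn_integral_pmf[symmetric])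
    also have "\<dots> = (\<integral>\<^sup>+\<tau>. ennreal (ST_mass \<theta> (Suc n) \<tau>) \<partial>count_space A)"
      using A by (intro nn_integral_cong) (auto simp: ST_mass_eq)
    also have "\<dots> = (\<integral>\<^sup>+\<tau>. ennreal (ST_mass \<theta> (Suc n) \<tau>) * indicator A \<tau> \<partial>count_space ?R)"
    proof -
      have "?R \<inter> A = A" using A by auto
      then show ?thesis
        using nn_integral_restrict_space[of A "count_space ?R" "\<lambda>\<tau>. ennreal (ST_mass \<theta> (Suc n) \<tau>)"] A
        by (simp add: restrict_count_space Int_commute)
    qed
    also have "\<dots> = emeasure (ST \<theta> (Suc n)) A"
      unfolding ST_def point_measure_def using A by (simp add: emeasure_density)
    finally show "emeasure (distr ?M (count_space ?R) (\<lambda>\<omega>. \<omega> n)) A = emeasure (ST \<theta> (Suc n)) A" .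
  qed (simp add: ST_def sets_point_measure)
  have incl: "\<omega> n \<subseteq> \<omega> (Suc n)" "\<omega> n \<subseteq> ulam_harris" if "\<omega> \<in> space ?M" for \<omega> n
  proof -
    show "\<omega> n \<subseteq> \<omega> (Suc n)"
      using state[OF that, of n] set_grow[of "\<omega> n" "\<omega> (Suc n)"] unfolding set_tree_law by blast
    show "\<omega> n \<subseteq> ulam_harris" using rooted[OF that, of n] by (simp add: rooted_subtrees_def rooted_subtree_def)
  qed
  show ?thesis
  proof (intro exI conjI ballI allI impI)
    show "markov_process ?M rooted_subtrees ?T" by (rule markov)
    fix n :: nat assume "1 \<le> n"
    then obtain m where n: "n = Suc m" by (cases n) auto
    show "distr ?M (count_space (rooted_subtrees n)) (?T n) = ST \<theta> n" using law[of m] n by simp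
    fix \<omega> assume "\<omega> \<in> space ?M"
    from incl[OF this, of m] show "?T n \<omega> \<subseteq> ?T (Suc n) \<omega>" "?T n \<omega> \<subseteq> ulam_harris" by (simp_all add: n)
  qed
qed

end

theorem theorem3:
  fixes \<theta> :: "nat \<Rightarrow> real"
  assumes "\<And>i. 1 \<le> i \<Longrightarrow> 0 \<le> \<theta> i"
    and "\<theta> summable_on {1..}"
    and "0 < infsum \<theta> {1..}"
  shows "\<exists>(M :: (nat \<Rightarrow> nat list set) measure) (T :: nat \<Rightarrow> (nat \<Rightarrow> nat list set) \<Rightarrow> nat list set).
           markov_process M rooted_subtrees T \<and>
           (\<forall>n\<ge>1. distr M (count_space (rooted_subtrees n)) (T n) = ST \<theta> n) \<and>
           (\<forall>\<omega>\<in>space M. \<forall>n\<ge>1. T n \<omega> \<subseteq> T (Suc n) \<omega> \<and> T n \<omega> \<subseteq> ulam_harris)"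
proof -
  \<comment> \<open>Letters of trees start at 1, so giving the letter 0 the weight 0 leaves their weights unchanged.\<close>
  let ?\<theta> = "\<theta>(0 := 0)"
  have "?\<theta> summable_on {1..}" using assms(2) by (rule summable_on_cong[THEN iffD1, rotated]) auto
  then have "?\<theta> summable_on UNIV" by (rule summable_on_cong_neutral[THEN iffD1, rotated -1]) (auto simp: not_le)
  then have summable: "summable ?\<theta>" by (rule summable_on_UNIV_nonneg_real_iff[THEN iffD1, rotated]) (use assms(1) in auto)
  have "\<exists>i. 0 < ?\<theta> i"
  proof (rule ccontr)
    assume "\<nexists>i. 0 < ?\<theta> i"
    then have "\<theta> i = 0" if "i \<in> {1..}" for i
      using assms(1)[of i] that by (metis atLeast_iff fun_upd_other less_le not_one_le_zero)
    then have "infsum \<theta> {1..} = 0" by (rule infsum_0)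
    then show False using assms(3) by simp
  qed
  then interpret edge_weights ?\<theta>
    using assms(1) summable by unfold_locales auto
  have "weight ?\<theta> = weight \<theta>"
    unfolding weight_def by (intro ext prod.cong) auto
  then have "ST ?\<theta> = ST \<theta>" unfolding ST_def ST_mass_def by (intro ext) simp
  then show ?thesis using coupling_exists by simp
qed

end
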